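(* Let $M=\mathbb{CP}^2\#2\overline{\mathbb{CP}^2}$ be the blow-up of $\mathbb{CP}^2$ at the two points $p_1=[0,1,0]$ and $p_2=[0,0,1]$, and let $G$ be the group of automorphisms of $M$ generated by the lifts of the coordinate phase rotations of $\mathbb{CP}^2$ and the lift of the transposition $[Z_0,Z_1,Z_2]\mapsto[Z_0,Z_2,Z_1]$. Then the $\alpha$-invariant of $M$ with respect to $G$ is $$\alpha_G(M)=\frac13 .$$
   Context: Realization of $M$: $M$ is the subvariety of $\mathbb{CP}^2\times\mathbb{CP}^1\times\mathbb{CP}^1$, with homogeneous coordinates $[Z_0,Z_1,Z_2]$, $[X_0,X_1]$, $[Y_0,Y_2]$, defined by $Z_0X_1=Z_1X_0$ and $Z_0Y_2=Z_2Y_0$. The group $G$: it is generated by the following automorphisms of $M$. For $\theta\in[0,2\pi)$ and $j\in\{0,1,2\}$, $\theta_j$ is the lift to $M$ of the automorphism of $\mathbb{CP}^2$ multiplying $Z_j$ by $e^{i\theta}$ and fixing the other two coordinates (so $\theta_0$ also multiplies $X_0$ and $Y_0$ by $e^{i\theta}$, $\theta_1$ also multiplies $X_1$ by $e^{i\theta}$, and $\theta_2$ also multiplies $Y_2$ by $e^{i\theta}$). Further, $\tau$ sends $[Z_0,Z_1,Z_2]\times[X_0,X_1]\times[Y_0,Y_2]$ to $[Z_0,Z_2,Z_1]\times[Y_0,Y_2]\times[X_0,X_1]$. Metric: let $\omega$ be the restriction to $M$ of $$\sqrt{-1}\,\partial\overline\partial\log(|Z_0|^2+|Z_1|^2+|Z_2|^2)+\sqrt{-1}\,\partial\overline\partial\log(|X_0|^2+|X_1|^2)+\sqrt{-1}\,\partial\overline\partial\log(|Y_0|^2+|Y_2|^2).$$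 It is a $G$-invariant Kähler form representing the first Chern class of $M$ (up to the usual factor $2\pi$). The $\alpha$-invariant: let $P_G(M,\omega)$ be the set of $G$-invariant smooth functions $\varphi:M\to\mathbb{R}$ with $\omega+\sqrt{-1}\,\partial\overline\partial\varphi>0$ and $\sup_M\varphi=0$. Then, with $n=\dim_{\mathbb C}M=2$, $$\alpha_G(M)=\sup\Big\{\alpha>0:\ \exists\,C>0\text{ such that }\int_M e^{-\alpha\varphi}\,\omega^n\le C\ \text{ for all }\varphi\in P_G(M,\omega)\Big\}.$$ *)

theory Defs
  imports "HOL-Analysis.Analysis" "HOL-Algebra.Bij" "HOL-Algebra.Generated_Groups"
begin

section \<open>Calculus on complex coordinate space\<close>

(* C^k on all of the space, by recursion over directional derivatives *)
primrec Ck :: "nat \<Rightarrow> ('a::euclidean_space \<Rightarrow> real) \<Rightarrow> bool" where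
  "Ck 0 f \<longleftrightarrow> continuous_on UNIV f"
| "Ck (Suc k) f \<longleftrightarrow>
     (\<forall>x. f differentiable at x) \<and> (\<forall>v. Ck k (\<lambda>x. frechet_derivative f (at x) v))"

definition smooth :: "('a::euclidean_space \<Rightarrow> real) \<Rightarrow> bool" where
  "smooth f \<longleftrightarrow> (\<forall>k. Ck k f)"

(* Wirtinger derivatives d/dz_j and d/d(cnj z_j); the Frechet derivative is the real one *)
definition wirt :: "'n::finite \<Rightarrow> (complex^'n \<Rightarrow> complex) \<Rightarrow> complex^'n \<Rightarrow> complex" where
  "wirt j f z =
     (frechet_derivative f (at z) (axis j 1) - \<i> * frechet_derivative f (at z) (axis j \<i>)) / 2"

definition wirt_bar :: "'n::finite \<Rightarrow> (complex^'n \<Rightarrow> complex) \<Rightarrow> complex^'n \<Rightarrow> complex" where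
  "wirt_bar j f z =
     (frechet_derivative f (at z) (axis j 1) + \<i> * frechet_derivative f (at z) (axis j \<i>)) / 2"

(* coefficient matrix g of  i ddbar u = i (SUM j k. g_jk  dz_j /\ d(cnj z_k)) *)
definition ddbar :: "(complex^'n::finite \<Rightarrow> real) \<Rightarrow> complex^'n \<Rightarrow> complex^'n^'n" where
  "ddbar u z = (\<chi> j k. wirt j (wirt_bar k (\<lambda>w. complex_of_real (u w))) z)"

(* Positivity of the real (1,1)-form with coefficient matrix A. For Hermitian A, hence for
   every ddbar u with u smooth, the sum is a real number. *)
definition pos_form :: "complex^'n^'n::finite \<Rightarrow> bool" where
  "pos_form A \<longleftrightarrow> (\<forall>v. v \<noteq> 0 \<longrightarrow>
     0 < Re (\<Sum>j\<in>UNIV. \<Sum>k\<in>UNIV. A $ j $ k * v $ j * cnj (v $ k)))"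


section \<open>The surface\<close>

(* A point of projective space is the set of all its homogeneous coordinate vectors. *)
definition hclass :: "complex^'n::finite \<Rightarrow> (complex^'n) set" where
  "hclass v = {c *s v | c. c \<noteq> 0}"

(* Coordinates are indexed from 0: type 3 is {0,1,2} and type 2 is {0,1}. *)
definition vec3 :: "complex \<Rightarrow> complex \<Rightarrow> complex \<Rightarrow> complex^3" where
  "vec3 a b c = (\<chi> i. if i = 0 then a else if i = 1 then b else c)"

definition vec2 :: "complex \<Rightarrow> complex \<Rightarrow> complex^2" where
  "vec2 a b = (\<chi> i. if i = 0 then a else b)"

type_synonym hcoords = "(complex^3) \<times> (complex^2) \<times> (complex^2)"
type_synonym point = "(complex^3) set \<times> (complex^2) set \<times> (complex^2) set"

definition to_point :: "hcoords \<Rightarrow> point" where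
  "to_point = (\<lambda>(Z, X, Y). (hclass Z, hclass X, hclass Y))"

(* The homogeneous coordinates [Y_0, Y_2] of the last factor are Y $ 0 and Y $ 1. *)
definition surface :: "point set" where
  "surface = {to_point (Z, X, Y) | Z X Y.
     Z \<noteq> 0 \<and> X \<noteq> 0 \<and> Y \<noteq> 0 \<and>
     Z $ 0 * X $ 1 = Z $ 1 * X $ 0 \<and> Z $ 0 * Y $ 1 = Z $ 2 * Y $ 0}"

(* The complex structure: five holomorphic parametrizations, each by all of C^2, given by lifts to
   homogeneous coordinates. Their images are the affine pieces
     Z_0 = 1;   Z_1 = Y_0 = 1;   Z_1 = Y_2 = 1;   Z_2 = X_0 = 1;   Z_2 = X_1 = 1
   of the surface, in this order. *)
definition lifts :: "(complex^2 \<Rightarrow> hcoords) list" where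
  "lifts =
    [\<lambda>z. let a = z $ 0; b = z $ 1 in (vec3 1 a b, vec2 1 a, vec2 1 b),
     \<lambda>z. let a = z $ 0; b = z $ 1 in (vec3 a 1 (a * b), vec2 a 1, vec2 1 b),
     \<lambda>z. let a = z $ 0; b = z $ 1 in (vec3 (a * b) 1 b, vec2 (a * b) 1, vec2 a 1),
     \<lambda>z. let a = z $ 0; b = z $ 1 in (vec3 a (a * b) 1, vec2 1 b, vec2 a 1),
     \<lambda>z. let a = z $ 0; b = z $ 1 in (vec3 (a * b) b 1, vec2 a 1, vec2 (a * b) 1)]"

definition chart :: "nat \<Rightarrow> complex^2 \<Rightarrow> point" where
  "chart k z = to_point ((lifts ! k) z)"

definition smooth_on_surface :: "(point \<Rightarrow> real) \<Rightarrow> bool" where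
  "smooth_on_surface \<phi> \<longleftrightarrow> (\<forall>k < length lifts. smooth (\<lambda>z. \<phi> (chart k z)))"


section \<open>The Kaehler form and its volume form\<close>

definition log_norms :: "hcoords \<Rightarrow> real" where
  "log_norms = (\<lambda>(Z, X, Y).
     ln (\<Sum>i\<in>UNIV. (cmod (Z $ i))\<^sup>2) + ln (\<Sum>i\<in>UNIV. (cmod (X $ i))\<^sup>2)
       + ln (\<Sum>i\<in>UNIV. (cmod (Y $ i))\<^sup>2))"

(* Coefficient matrix of omega in the k-th chart. The form i ddbar (log_norms o s) is the same for
   every local holomorphic lift s to homogeneous coordinates. *)
definition omega :: "nat \<Rightarrow> complex^2 \<Rightarrow> complex^2^2" where
  "omega k = ddbar (\<lambda>z. log_norms ((lifts ! k) z))"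

(* The integral of f omega^2 for f >= 0. In a chart, with omega = i (SUM j k. g_jk dz_j /\ d(cnj z_k))
   and i dz /\ d(cnj z) = 2 dx /\ dy,
     omega^2 = 2 det g (i dz_0 /\ d(cnj z_0)) /\ (i dz_1 /\ d(cnj z_1)) = 8 det g dLebesgue.
   The surface is the disjoint union of the pieces lying in the k-th chart image but in no earlier
   one. *)
definition integral_omega_sq :: "(point \<Rightarrow> ennreal) \<Rightarrow> ennreal" where
  "integral_omega_sq f =
     (\<Sum>k < length lifts. \<integral>\<^sup>+ z. f (chart k z) * ennreal (8 * Re (det (omega k z)))
        * indicator {z. chart k z \<notin> (\<Union>j<k. range (chart j))} z \<partial>lborel)"


section \<open>The symmetry group\<close>

definition mult_coord :: "'n::finite \<Rightarrow> complex \<Rightarrow> complex^'n \<Rightarrow> complex^'n" where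
  "mult_coord j c v = (\<chi> i. if i = j then c * v $ i else v $ i)"

definition rot0 :: "real \<Rightarrow> point \<Rightarrow> point" where
  "rot0 \<theta> = (\<lambda>(L, P, Q). (mult_coord 0 (cis \<theta>) ` L, mult_coord 0 (cis \<theta>) ` P, mult_coord 0 (cis \<theta>) ` Q))"

definition rot1 :: "real \<Rightarrow> point \<Rightarrow> point" where
  "rot1 \<theta> = (\<lambda>(L, P, Q). (mult_coord 1 (cis \<theta>) ` L, mult_coord 1 (cis \<theta>) ` P, Q))"

definition rot2 :: "real \<Rightarrow> point \<Rightarrow> point" where
  "rot2 \<theta> = (\<lambda>(L, P, Q). (mult_coord 2 (cis \<theta>) ` L, P, mult_coord 1 (cis \<theta>) ` Q))"

definition flip :: "point \<Rightarrow> point" where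
  "flip = (\<lambda>(L, P, Q). ((\<lambda>Z. vec3 (Z $ 0) (Z $ 2) (Z $ 1)) ` L, Q, P))"

definition sym_gens :: "(point \<Rightarrow> point) set" where
  "sym_gens =
     (\<Union>\<theta>\<in>{0..<2*pi}. {restrict (rot0 \<theta>) surface, restrict (rot1 \<theta>) surface, restrict (rot2 \<theta>) surface})
     \<union> {restrict flip surface}"

definition sym_group :: "(point \<Rightarrow> point) set" where
  "sym_group = generate (BijGroup surface) sym_gens"


section \<open>The alpha-invariant\<close>

definition potentials :: "(point \<Rightarrow> point) set \<Rightarrow> (point \<Rightarrow> real) set" where
  "potentials G = {\<phi>.
     smooth_on_surface \<phi> \<and>
     (\<forall>g\<in>G. \<forall>p\<in>surface. \<phi> (g p) = \<phi> p) \<and>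
     (\<forall>k < length lifts. \<forall>z. pos_form (omega k z + ddbar (\<lambda>w. \<phi> (chart k w)) z)) \<and>
     (SUP p\<in>surface. \<phi> p) = 0}"

(* The supremum is taken in the extended reals, so that an unbounded set of exponents
   would give infinity. *)
definition alpha_invariant :: "(point \<Rightarrow> point) set \<Rightarrow> ereal" where
  "alpha_invariant G = Sup (ereal ` {\<alpha>. \<alpha> > 0 \<and>
     (\<exists>C>0. \<forall>\<phi>\<in>potentials G.
        integral_omega_sq (\<lambda>p. ennreal (exp (- \<alpha> * \<phi> p))) \<le> ennreal C)})"


section \<open>Consistency of the definitions\<close>

lemma all3: "(\<forall>i::3. P i) \<longleftrightarrow> P 0 \<and> P 1 \<and> P 2"
proof -
  have "(3::3) = 0" by simp
  then show ?thesis using forall_3[of P] by metis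
qed

lemma all2: "(\<forall>i::2. P i) \<longleftrightarrow> P 0 \<and> P 1"
proof -
  have "(2::2) = 0" by simp
  then show ?thesis using forall_2[of P] by metis
qed

lemma vec_nth_simps [simp]:
  "vec3 a b c $ 0 = a" "vec3 a b c $ 1 = b" "vec3 a b c $ 2 = c"
  "vec2 a b $ 0 = a" "vec2 a b $ 1 = b"
  by (simp_all add: vec3_def vec2_def)

lemma vec3_eq_iff: "v = w \<longleftrightarrow> v $ 0 = w $ 0 \<and> v $ 1 = w $ 1 \<and> v $ 2 = w $ 2" for v w :: "complex^3"
  by (simp add: vec_eq_iff all3)

lemma vec2_eq_iff: "v = w \<longleftrightarrow> v $ 0 = w $ 0 \<and> v $ 1 = w $ 1" for v w :: "complex^2"
  by (simp add: vec_eq_iff all2)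

lemma hclass_eq_iff:
  "hclass v = hclass w \<longleftrightarrow> (\<exists>c. c \<noteq> 0 \<and> v = c *s w)"
proof
  assume eq: "hclass v = hclass w"
  have "v \<in> hclass v" unfolding hclass_def by (auto intro!: exI[of _ 1])
  then show "\<exists>c. c \<noteq> 0 \<and> v = c *s w" unfolding eq by (auto simp: hclass_def)
next
  assume "\<exists>c. c \<noteq> 0 \<and> v = c *s w"
  then obtain c where c: "c \<noteq> 0" "v = c *s w" by blast
  show "hclass v = hclass w"
  proof (intro Set.set_eqI iffI)
    fix u assume "u \<in> hclass v"
    then obtain d where "d \<noteq> 0" "u = d *s v" by (auto simp: hclass_def)
    then show "u \<in> hclass w" using c by (auto simp: hclass_def intro!: exI[of _ "d * c"])
  next
    fix u assume "u \<in> hclass w"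
    then obtain d where "d \<noteq> 0" "u = d *s w" by (auto simp: hclass_def)
    then show "u \<in> hclass v" using c by (auto simp: hclass_def intro!: exI[of _ "d / c"])
  qed
qed

lemma length_lifts: "length lifts = 5"
  by (simp add: lifts_def)

lemma less_5: "k < (5::nat) \<longleftrightarrow> k = 0 \<or> k = 1 \<or> k = 2 \<or> k = 3 \<or> k = 4"
  by auto

lemma lift_simps:
  "(lifts ! 0) z = (vec3 1 (z $ 0) (z $ 1), vec2 1 (z $ 0), vec2 1 (z $ 1))"
  "(lifts ! 1) z = (vec3 (z $ 0) 1 (z $ 0 * z $ 1), vec2 (z $ 0) 1, vec2 1 (z $ 1))"
  "(lifts ! 2) z = (vec3 (z $ 0 * z $ 1) 1 (z $ 1), vec2 (z $ 0 * z $ 1) 1, vec2 (z $ 0) 1)"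
  "(lifts ! 3) z = (vec3 (z $ 0) (z $ 0 * z $ 1) 1, vec2 1 (z $ 1), vec2 (z $ 0) 1)"
  "(lifts ! 4) z = (vec3 (z $ 0 * z $ 1) (z $ 1) 1, vec2 (z $ 0) 1, vec2 (z $ 0 * z $ 1) 1)"
  by (simp_all add: lifts_def Let_def)

lemma to_point_eq_iff:
  "to_point (Z, X, Y) = to_point (Z', X', Y') \<longleftrightarrow>
     (\<exists>c. c \<noteq> 0 \<and> Z = c *s Z') \<and> (\<exists>c. c \<noteq> 0 \<and> X = c *s X') \<and> (\<exists>c. c \<noteq> 0 \<and> Y = c *s Y')"
  by (simp add: to_point_def hclass_eq_iff)

lemma chart_inj: "k < length lifts \<Longrightarrow> inj (chart k)"
  unfolding length_lifts less_5
  by (rule injI)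
    (auto simp: chart_def lift_simps lift_simps[simplified] to_point_eq_iff vec3_eq_iff vec2_eq_iff)

lemma to_point_in_surface:
  assumes "Z \<noteq> 0" "X \<noteq> 0" "Y \<noteq> 0"
    and "Z $ 0 * X $ 1 = Z $ 1 * X $ 0" "Z $ 0 * Y $ 1 = Z $ 2 * Y $ 0"
  shows "to_point (Z, X, Y) \<in> surface"
  using assms unfolding surface_def by blast

lemma chart_in_surface: "k < length lifts \<Longrightarrow> chart k z \<in> surface"
  unfolding length_lifts less_5 chart_def
  by (elim disjE; simp only: lift_simps;
      rule to_point_in_surface; simp add: vec3_eq_iff vec2_eq_iff)

lemma surface_covered: "surface \<subseteq> (\<Union>k < length lifts. range (chart k))"
proof
  fix p assume "p \<in> surface"
  then obtain Z X Y where p: "p = to_point (Z, X, Y)"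
    and nz: "Z \<noteq> 0" "X \<noteq> 0" "Y \<noteq> 0"
    and e1: "Z $ 0 * X $ 1 = Z $ 1 * X $ 0" and e2: "Z $ 0 * Y $ 1 = Z $ 2 * Y $ 0"
    unfolding surface_def by blast
  have ex: "\<exists>k<5. \<exists>z. p = chart k z"
    if "k < 5" "to_point (Z, X, Y) = to_point ((lifts ! k) z)" for k z
    using that p by (auto simp: chart_def)
  consider "Z $ 0 \<noteq> 0" | "Z $ 1 \<noteq> 0" "Y $ 0 \<noteq> 0" | "Z $ 1 \<noteq> 0" "Y $ 1 \<noteq> 0"
    | "Z $ 2 \<noteq> 0" "X $ 0 \<noteq> 0" | "Z $ 2 \<noteq> 0" "X $ 1 \<noteq> 0"
    using nz by (auto simp: vec3_eq_iff vec2_eq_iff)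
  then have "\<exists>k<5. \<exists>z. p = chart k z"
  proof cases
    case 1
    then have "X $ 0 \<noteq> 0" "Y $ 0 \<noteq> 0" using e1 e2 nz by (auto simp: vec2_eq_iff)
    then show ?thesis using 1 e1 e2
      by (intro ex[of 0 "vec2 (Z $ 1 / Z $ 0) (Z $ 2 / Z $ 0)"])
        (simp_all add: lift_simps lift_simps[simplified] to_point_eq_iff vec3_eq_iff vec2_eq_iff,
          auto intro!: exI[of _ "Z $ 0"] exI[of _ "X $ 0"] exI[of _ "Y $ 0"] simp: field_simps)
  next
    case 2
    then have "X $ 1 \<noteq> 0" using e1 e2 nz by (auto simp: vec2_eq_iff)
    then show ?thesis using 2 e1 e2
      by (intro ex[of 1 "vec2 (Z $ 0 / Z $ 1) (Y $ 1 / Y $ 0)"])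
        (simp_all add: lift_simps lift_simps[simplified] to_point_eq_iff vec3_eq_iff vec2_eq_iff,
          auto intro!: exI[of _ "Z $ 1"] exI[of _ "X $ 1"] exI[of _ "Y $ 0"] simp: field_simps)
  next
    case 3
    then have "X $ 1 \<noteq> 0" using e1 e2 nz by (auto simp: vec2_eq_iff)
    moreover have "X $ 0 * (Y $ 1 * Z $ 1) = X $ 1 * (Y $ 0 * Z $ 2)"
      using e1 e2 by (metis mult.commute mult.left_commute)
    ultimately show ?thesis using 3 e1 e2
      by (intro ex[of 2 "vec2 (Y $ 0 / Y $ 1) (Z $ 2 / Z $ 1)"])
        (simp_all add: lift_simps lift_simps[simplified] to_point_eq_iff vec3_eq_iff vec2_eq_iff,
          auto intro!: exI[of _ "Z $ 1"] exI[of _ "X $ 1"] exI[of _ "Y $ 1"] simp: field_simps)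
  next
    case 4
    then have "Y $ 1 \<noteq> 0" using e1 e2 nz by (auto simp: vec2_eq_iff)
    then show ?thesis using 4 e1 e2
      by (intro ex[of 3 "vec2 (Z $ 0 / Z $ 2) (X $ 1 / X $ 0)"])
        (simp_all add: lift_simps lift_simps[simplified] to_point_eq_iff vec3_eq_iff vec2_eq_iff,
          auto intro!: exI[of _ "Z $ 2"] exI[of _ "X $ 0"] exI[of _ "Y $ 1"] simp: field_simps)
  next
    case 5
    then have "Y $ 1 \<noteq> 0" using e1 e2 nz by (auto simp: vec2_eq_iff)
    moreover have "X $ 1 * (Y $ 0 * Z $ 2) = X $ 0 * (Y $ 1 * Z $ 1)"
      using e1 e2 by (metis mult.commute mult.left_commute)
    ultimately show ?thesis using 5 e1 e2
      by (intro ex[of 4 "vec2 (X $ 0 / X $ 1) (Z $ 1 / Z $ 2)"])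
        (simp_all add: lift_simps lift_simps[simplified] to_point_eq_iff vec3_eq_iff vec2_eq_iff,
          auto intro!: exI[of _ "Z $ 2"] exI[of _ "X $ 1"] exI[of _ "Y $ 1"] simp: field_simps)
  qed
  then show "p \<in> (\<Union>k < length lifts. range (chart k))" by (auto simp: length_lifts)
qed

lemma image_hclass:
  assumes "\<And>c v. f (c *s v) = c *s f v"
  shows "f ` hclass v = hclass (f v)"
  using assms by (auto simp: hclass_def image_iff) metis

lemma mult_coord_hclass: "mult_coord j c ` hclass v = hclass (mult_coord j c v)"
  by (rule image_hclass) (simp add: mult_coord_def vec_eq_iff)

lemma swap_hclass:
  "(\<lambda>Z. vec3 (Z $ 0) (Z $ 2) (Z $ 1)) ` hclass v = hclass (vec3 (v $ 0) (v $ 2) (v $ 1))"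
  by (rule image_hclass) (simp add: vec3_eq_iff)

lemma gens_to_point:
  "rot0 \<theta> (to_point (Z, X, Y)) =
     to_point (mult_coord 0 (cis \<theta>) Z, mult_coord 0 (cis \<theta>) X, mult_coord 0 (cis \<theta>) Y)"
  "rot1 \<theta> (to_point (Z, X, Y)) = to_point (mult_coord 1 (cis \<theta>) Z, mult_coord 1 (cis \<theta>) X, Y)"
  "rot2 \<theta> (to_point (Z, X, Y)) = to_point (mult_coord 2 (cis \<theta>) Z, X, mult_coord 1 (cis \<theta>) Y)"
  "flip (to_point (Z, X, Y)) = to_point (vec3 (Z $ 0) (Z $ 2) (Z $ 1), Y, X)"
  by (simp_all add: rot0_def rot1_def rot2_def flip_def to_point_def mult_coord_hclass swap_hclass)

lemma gens_in_surface:
  assumes "p \<in> surface"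
  shows "rot0 \<theta> p \<in> surface" "rot1 \<theta> p \<in> surface" "rot2 \<theta> p \<in> surface" "flip p \<in> surface"
proof -
  obtain Z X Y where p: "p = to_point (Z, X, Y)"
    and nz: "Z \<noteq> 0" "X \<noteq> 0" "Y \<noteq> 0"
    and e: "Z $ 0 * X $ 1 = Z $ 1 * X $ 0" "Z $ 0 * Y $ 1 = Z $ 2 * Y $ 0"
    using assms unfolding surface_def by blast
  have mc2: "mult_coord j (cis \<theta>) v \<noteq> 0" if "v \<noteq> 0" for j and v :: "complex^2"
    using that by (auto simp: mult_coord_def vec_eq_iff split: if_splits)
  have mc3: "mult_coord j (cis \<theta>) v \<noteq> 0" if "v \<noteq> 0" for j and v :: "complex^3"
    using that by (auto simp: mult_coord_def vec_eq_iff split: if_splits)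
  show "rot0 \<theta> p \<in> surface" "rot1 \<theta> p \<in> surface" "rot2 \<theta> p \<in> surface"
    unfolding p gens_to_point using nz e
    by (intro to_point_in_surface mc2 mc3; simp add: mult_coord_def)+
  show "flip p \<in> surface"
    unfolding p gens_to_point using nz e by (intro to_point_in_surface) (auto simp: vec3_eq_iff)
qed

lemma gens_inverse:
  assumes "p \<in> surface"
  shows "rot0 \<theta> (rot0 (- \<theta>) p) = p" "rot1 \<theta> (rot1 (- \<theta>) p) = p"
    "rot2 \<theta> (rot2 (- \<theta>) p) = p" "flip (flip p) = p"
proof -
  obtain Z X Y where p: "p = to_point (Z, X, Y)"
    using assms unfolding surface_def by blast
  have c: "mult_coord j (cis \<theta>) (mult_coord j (cis (- \<theta>)) v) = v" for j and v :: "complex^2"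
    by (simp add: mult_coord_def vec_eq_iff cis_mult flip: mult.assoc)
  have c': "mult_coord j (cis \<theta>) (mult_coord j (cis (- \<theta>)) v) = v" for j and v :: "complex^3"
    by (simp add: mult_coord_def vec_eq_iff cis_mult flip: mult.assoc)
  show "rot0 \<theta> (rot0 (- \<theta>) p) = p" "rot1 \<theta> (rot1 (- \<theta>) p) = p" "rot2 \<theta> (rot2 (- \<theta>) p) = p"
    by (simp_all add: p gens_to_point c c')
  have "vec3 (Z $ 0) (Z $ 1) (Z $ 2) = Z" by (simp add: vec3_eq_iff)
  then show "flip (flip p) = p" by (simp add: p gens_to_point)
qed

lemma sym_gens_bij: "sym_gens \<subseteq> carrier (BijGroup surface)"
proof -
  have *: "restrict f surface \<in> carrier (BijGroup surface)"
    if "\<And>p. p \<in> surface \<Longrightarrow> f p \<in> surface" "\<And>p. p \<in> surface \<Longrightarrow> g p \<in> surface"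
      "\<And>p. p \<in> surface \<Longrightarrow> f (g p) = p" "\<And>p. p \<in> surface \<Longrightarrow> g (f p) = p" for f g
  proof -
    have "bij_betw f surface surface"
      by (rule bij_betw_byWitness[of _ g]) (use that in auto)
    then show ?thesis by (simp add: BijGroup_def Bij_def)
  qed
  have "restrict (rot0 \<theta>) surface \<in> carrier (BijGroup surface)"
    "restrict (rot1 \<theta>) surface \<in> carrier (BijGroup surface)"
    "restrict (rot2 \<theta>) surface \<in> carrier (BijGroup surface)" for \<theta>
    using *[of "rot0 \<theta>" "rot0 (- \<theta>)"] *[of "rot1 \<theta>" "rot1 (- \<theta>)"] *[of "rot2 \<theta>" "rot2 (- \<theta>)"]
      gens_in_surface gens_inverse(1-3)[where \<theta> = \<theta>]
      gens_inverse(1-3)[where \<theta> = "- \<theta>"] by simp_all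
  moreover have "restrict flip surface \<in> carrier (BijGroup surface)"
    using *[of flip flip] gens_in_surface gens_inverse by blast
  ultimately show ?thesis by (auto simp: sym_gens_def)
qed

end

(*
In logarithmic coordinates |a| = e^s, |b| = e^t on the open torus orbit, an invariant omega-plurisubharmonic
function phi becomes u - u0 with u convex and symmetric, where u0 = ln (weight) is the potential of omega
and differs by a bounded amount from the support function of the anticanonical polytope
{0 <= p, q <= 2, p + q <= 3}; since u <= u0, the slopes of u lie in this polytope.

Lower bound. As sup phi = 0, convexity and linear growth give u(x) >= - support(- x) along the diagonal, and symmetry
then gives u(s, t) >= min 0 (3 (s + t)) everywhere. Hence exp (- alpha phi) omega^2 is dominated by an explicit
density, integrable for alpha < 1/3.

Upper bound. The dilations a, b -> r a, r b act on the surface, and the potentials of the pulled back forms decrease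
to - u0 as r -> 0; the integral of exp (- alpha phi) over |a|, |b| of order 1/r is of order r^(2 - 6 alpha).
*)
theory Submission
  imports Defs
begin

section \<open>Smooth functions\<close>

text \<open>The value 1/3 is decided at infinity of the torus chart. There exp (- alpha phi) omega^2
  is controlled by \<open>weight\<close> powr (alpha - 1), of order R^(6 alpha - 6) where |a| and
  |b| are of order R, a region of volume of order R^4; the exponent 6 alpha - 2 is that of the
  dilations. The other factor, |a b| powr (- 3 alpha) near the axes, stays integrable up to 2/3. The
  lower bound of u has to be uniform in phi, which is normalized only through its supremum. A convex
  function on the whole plane that stays below the support function plus a constant has all its
  increments bounded by the support function itself: the constant drops out. One point with phi > -
  epsilon then bounds u from below everywhere, with no constant that depends on phi. Since |a|^2 =
  e^(2 s), slopes in s and t lie in twice the polytope. Its edge on p + q = 3 gives the value 6 max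
  0 (- m) of the support function at (- m, - m), that is 3 (s + t) at the midpoint m = (s + t) /
  2.\<close>

abbreviation dir_deriv :: "'a::euclidean_space \<Rightarrow> ('a \<Rightarrow> real) \<Rightarrow> 'a \<Rightarrow> real" where
  "dir_deriv v f \<equiv> \<lambda>x. frechet_derivative f (at x) v"

text \<open>A class of functions stable under directional derivatives, so that \<open>Ck\<close>
  follows for all orders by one induction. It contains the logarithms of norms from which
  \<open>omega\<close> and the test potentials are built.\<close>

inductive elementary :: "('a::euclidean_space \<Rightarrow> real) \<Rightarrow> bool" where
  elementary_linear: "bounded_linear f \<Longrightarrow> elementary f"
| elementary_const: "elementary (\<lambda>_. c)"
| elementary_add: "elementary f \<Longrightarrow> elementary g \<Longrightarrow> elementary (\<lambda>x. f x + g x)"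
| elementary_mult: "elementary f \<Longrightarrow> elementary g \<Longrightarrow> elementary (\<lambda>x. f x * g x)"
| elementary_inverse: "elementary f \<Longrightarrow> (\<And>x. f x \<noteq> 0) \<Longrightarrow> elementary (\<lambda>x. inverse (f x))"
| elementary_ln: "elementary f \<Longrightarrow> (\<And>x. f x > 0) \<Longrightarrow> elementary (\<lambda>x. ln (f x))"

lemma dir_deriv_eqI:
  "(\<And>x. (f has_derivative f' x) (at x)) \<Longrightarrow> dir_deriv v f = (\<lambda>x. f' x v)"
  by (rule ext) (metis frechet_derivative_at)

lemma elementary_dir_deriv:
  "elementary f \<Longrightarrow> (\<forall>x. f differentiable (at x)) \<and> (\<forall>v. elementary (dir_deriv v f))"
proof (induction rule: elementary.induct)
  case (elementary_linear f)
  then have d: "(f has_derivative f) (at x)" for x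
    by (rule bounded_linear_imp_has_derivative)
  have "dir_deriv v f = (\<lambda>x. f v)" for v
    by (rule dir_deriv_eqI) (rule d)
  with d show ?case by (auto simp: differentiable_def intro: elementary.intros)
next
  case (elementary_const c)
  then show ?case by (auto intro: elementary.intros)
next
  case (elementary_add f g)
  then have d: "((\<lambda>x. f x + g x) has_derivative
      (\<lambda>v. dir_deriv v f x + dir_deriv v g x)) (at x)" for x
    by (auto intro!: derivative_eq_intros simp: frechet_derivative_works)
  have "dir_deriv v (\<lambda>x. f x + g x) = (\<lambda>x. dir_deriv v f x + dir_deriv v g x)" for v
    by (rule dir_deriv_eqI) (rule d)
  with d elementary_add show ?case by (auto simp: differentiable_def intro: elementary.intros)
next
  case (elementary_mult f g)
  then have d: "((\<lambda>x. f x * g x) has_derivative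
      (\<lambda>v. f x * dir_deriv v g x + dir_deriv v f x * g x)) (at x)" for x
    by (auto intro!: has_derivative_mult simp: frechet_derivative_works)
  have "dir_deriv v (\<lambda>x. f x * g x) = (\<lambda>x. f x * dir_deriv v g x + dir_deriv v f x * g x)" for v
    by (rule dir_deriv_eqI) (rule d)
  with d elementary_mult show ?case
    by (auto simp: differentiable_def intro!: elementary_add elementary.elementary_mult)
next
  case (elementary_inverse f)
  then have d: "((\<lambda>x. inverse (f x)) has_derivative
      (\<lambda>v. - (inverse (f x) * dir_deriv v f x * inverse (f x)))) (at x)" for x
    by (auto intro!: derivative_eq_intros simp: frechet_derivative_works)
  \<comment> \<open>The sign is written as a factor -1 because the class has rules for constants and
    products but none for negation.\<close>
  have "dir_deriv v (\<lambda>x. inverse (f x))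
      = (\<lambda>x. -1 * (inverse (f x) * dir_deriv v f x * inverse (f x)))" for v
    by (subst dir_deriv_eqI[OF d]) simp
  moreover have "elementary (\<lambda>x. -1 * (inverse (f x) * dir_deriv v f x * inverse (f x)))" for v
    using elementary_inverse
    by (intro elementary_mult elementary_const elementary.elementary_inverse) auto
  ultimately show ?case using d by (auto simp: differentiable_def)
next
  case (elementary_ln f)
  have d: "((\<lambda>x. ln (f x)) has_derivative (\<lambda>v. dir_deriv v f x * inverse (f x))) (at x)" for x
    using elementary_ln
    by (auto intro!: derivative_eq_intros simp: frechet_derivative_works)
  have "dir_deriv v (\<lambda>x. ln (f x)) = (\<lambda>x. dir_deriv v f x * inverse (f x))" for v
    by (rule dir_deriv_eqI) (rule d)
  moreover have "f x \<noteq> 0" for x using elementary_ln(2)[of x] by simp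
  ultimately show ?case using d elementary_ln
    by (auto simp: differentiable_def intro!: elementary_mult elementary_inverse)
qed

lemma smooth_elementary: "smooth f" if "elementary f"
proof -
  have "Ck k f" for k
    using that
  proof (induction k arbitrary: f)
    case 0
    then show ?case
      using elementary_dir_deriv[of f] differentiable_imp_continuous_within
      by (fastforce simp: continuous_on_eq_continuous_within)
  next
    case (Suc k)
    then show ?case using elementary_dir_deriv by auto
  qed
  then show ?thesis by (simp add: smooth_def)
qed

text \<open>The regularity that \<open>ddbar\<close> consumes: both layers of directional
  derivatives are Frechet differentiated at every point.\<close>

definition twice_differentiable :: "('a::euclidean_space \<Rightarrow> real) \<Rightarrow> bool" where
  "twice_differentiable f \<longleftrightarrow> (\<forall>x. f differentiable (at x)) \<and>
     (\<forall>v x. dir_deriv v f differentiable (at x))"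

lemma smooth_imp_twice_differentiable: "smooth f \<Longrightarrow> twice_differentiable f"
  unfolding smooth_def twice_differentiable_def
  by (drule spec[of _ "Suc (Suc 0)"]) simp

lemma smooth_imp_continuous: "smooth f \<Longrightarrow> continuous_on UNIV f"
  unfolding smooth_def by (drule spec[of _ 0]) simp

lemma dir_deriv_add:
  assumes "\<And>x. f differentiable (at x)" "\<And>x. g differentiable (at x)"
  shows "dir_deriv v (\<lambda>x. f x + g x) = (\<lambda>x. dir_deriv v f x + dir_deriv v g x)"
  using assms
  by (intro dir_deriv_eqI) (auto intro!: derivative_eq_intros simp: frechet_derivative_works)

lemma twice_differentiable_add:
  "twice_differentiable f \<Longrightarrow> twice_differentiable g \<Longrightarrow> twice_differentiable (\<lambda>x. f x + g x)"
  by (simp add: twice_differentiable_def dir_deriv_add)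

lemma frechet_derivative_of_real:
  "f differentiable (at x) \<Longrightarrow>
   frechet_derivative (\<lambda>w. complex_of_real (f w)) (at x) v = complex_of_real (dir_deriv v f x)"
  by (subst frechet_derivative_at[OF has_derivative_of_real, symmetric])
    (simp_all add: frechet_derivative_works)

text \<open>Expands the product of (d_x - i d_y) / 2 in the variable \<open>j\<close> and (d_x + i
  d_y) / 2 in the variable \<open>k\<close>. Additivity of \<open>ddbar\<close> and its relation to
  the real Hessian are read off from these real second derivatives.\<close>

lemma ddbar_entry:
  fixes u :: "complex^'n::finite \<Rightarrow> real"
  assumes "twice_differentiable u"
  shows "ddbar u z $ j $ k = Complex
    ((dir_deriv (axis j 1) (dir_deriv (axis k 1) u) z
       + dir_deriv (axis j \<i>) (dir_deriv (axis k \<i>) u) z) / 4)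
    ((dir_deriv (axis j 1) (dir_deriv (axis k \<i>) u) z
       - dir_deriv (axis j \<i>) (dir_deriv (axis k 1) u) z) / 4)"
proof -
  have d1: "u differentiable (at x)" for x using assms by (simp add: twice_differentiable_def)
  have d2: "dir_deriv v u differentiable (at x)" for v x
    using assms by (simp add: twice_differentiable_def)
  have wb: "wirt_bar k (\<lambda>w. complex_of_real (u w)) = (\<lambda>x.
      (complex_of_real (dir_deriv (axis k 1) u x) + \<i> * complex_of_real (dir_deriv (axis k \<i>) u x)) / 2)"
    by (rule ext) (simp add: wirt_bar_def frechet_derivative_of_real[OF d1])
  have "(wirt_bar k (\<lambda>w. complex_of_real (u w)) has_derivative (\<lambda>h.
      (complex_of_real (dir_deriv h (dir_deriv (axis k 1) u) z)
        + \<i> * complex_of_real (dir_deriv h (dir_deriv (axis k \<i>) u) z)) / 2)) (at z)"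
    unfolding wb using d2
    by (auto intro!: derivative_eq_intros simp: frechet_derivative_works)
  from frechet_derivative_at[OF this, symmetric] show ?thesis
    by (simp add: ddbar_def wirt_def complex_eq_iff)
qed

lemma ddbar_add:
  fixes u :: "complex^'n::finite \<Rightarrow> real"
  assumes "twice_differentiable u" "twice_differentiable v"
  shows "ddbar (\<lambda>z. u z + v z) z = ddbar u z + ddbar v z"
proof -
  have d: "dir_deriv a (dir_deriv b (\<lambda>z. u z + v z)) z
    = dir_deriv a (dir_deriv b u) z + dir_deriv a (dir_deriv b v) z" for a b
  proof -
    have 1: "dir_deriv b (\<lambda>z. u z + v z) = (\<lambda>z. dir_deriv b u z + dir_deriv b v z)"
      using assms by (intro dir_deriv_add) (simp_all add: twice_differentiable_def)
    have 2: "dir_deriv a (\<lambda>z. dir_deriv b u z + dir_deriv b v z)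
        = (\<lambda>z. dir_deriv a (dir_deriv b u) z + dir_deriv a (dir_deriv b v) z)"
      using assms by (intro dir_deriv_add) (simp_all add: twice_differentiable_def)
    show ?thesis unfolding 1 using fun_cong[OF 2] .
  qed
  have "ddbar (\<lambda>z. u z + v z) z $ j $ k = ddbar u z $ j $ k + ddbar v z $ j $ k" for j k
    unfolding ddbar_entry[OF twice_differentiable_add[OF assms]] ddbar_entry[OF assms(1)]
      ddbar_entry[OF assms(2)] d
    by (simp add: complex_eq_iff add_divide_distrib diff_divide_distrib)
  then show ?thesis by (intro vec_eq_iff[THEN iffD2] allI) (simp only: vector_add_component)
qed


section \<open>The form of a logarithm of a sum of squares\<close>

text \<open>Both Wirtinger coefficients are recorded at once: the calculus rules then act on the
  pair, conjugation exchanges its members up to \<open>cnj\<close>, and holomorphy means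
  \<open>Q = 0\<close>.\<close>

definition has_wirtinger ::
    "(complex^'n::finite \<Rightarrow> complex) \<Rightarrow> ('n \<Rightarrow> complex) \<Rightarrow> ('n \<Rightarrow> complex) \<Rightarrow> complex^'n \<Rightarrow> bool" where
  "has_wirtinger f P Q z \<longleftrightarrow>
     (f has_derivative (\<lambda>h. \<Sum>j\<in>UNIV. P j * h $ j + Q j * cnj (h $ j))) (at z)"

lemma sum_axis:
  fixes P :: "'n::finite \<Rightarrow> complex"
  shows "(\<Sum>i\<in>UNIV. P i * axis j c $ i + Q i * cnj (axis j c $ i)) = P j * c + Q j * cnj c"
proof -
  have "(\<Sum>i\<in>UNIV. P i * axis j c $ i + Q i * cnj (axis j c $ i))
      = (\<Sum>i\<in>UNIV. if i = j then P j * c + Q j * cnj c else 0)"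
    by (rule sum.cong) (auto simp: axis_def)
  then show ?thesis by simp
qed

lemma has_wirtinger_imp_wirt:
  assumes "has_wirtinger f P Q z"
  shows "wirt j f z = P j" "wirt_bar j f z = Q j"
proof -
  have "frechet_derivative f (at z) = (\<lambda>h. \<Sum>j\<in>UNIV. P j * h $ j + Q j * cnj (h $ j))"
    using assms unfolding has_wirtinger_def by (rule frechet_derivative_at[symmetric])
  then show "wirt j f z = P j" "wirt_bar j f z = Q j"
    by (simp_all add: wirt_def wirt_bar_def sum_axis algebra_simps flip: mult.assoc)
qed

lemma has_wirtinger_mult:
  assumes "has_wirtinger f P Q z" "has_wirtinger g P' Q' z"
  shows "has_wirtinger (\<lambda>w. f w * g w) (\<lambda>j. f z * P' j + P j * g z) (\<lambda>j. f z * Q' j + Q j * g z) z"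
  using has_derivative_mult[OF assms[unfolded has_wirtinger_def]]
  unfolding has_wirtinger_def
  by (rule has_derivative_eq_rhs)
    (simp add: fun_eq_iff sum_distrib_left sum_distrib_right sum.distrib algebra_simps)

lemma has_wirtinger_sum:
  assumes "\<And>i. i \<in> I \<Longrightarrow> has_wirtinger (f i) (P i) (Q i) z"
  shows "has_wirtinger (\<lambda>w. \<Sum>i\<in>I. f i w) (\<lambda>j. \<Sum>i\<in>I. P i j) (\<lambda>j. \<Sum>i\<in>I. Q i j) z"
proof -
  have "((\<lambda>w. \<Sum>i\<in>I. f i w) has_derivative
      (\<lambda>h. \<Sum>i\<in>I. \<Sum>j\<in>UNIV. P i j * h $ j + Q i j * cnj (h $ j))) (at z)"
    using assms unfolding has_wirtinger_def by (rule has_derivative_sum)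
  then show ?thesis unfolding has_wirtinger_def
    by (rule has_derivative_eq_rhs)
      (auto simp: fun_eq_iff sum_distrib_right sum.distrib intro!: arg_cong2[where f="(+)"] sum.swap)
qed

lemma has_wirtinger_cnj:
  assumes "has_wirtinger f P Q z"
  shows "has_wirtinger (\<lambda>w. cnj (f w)) (\<lambda>j. cnj (Q j)) (\<lambda>j. cnj (P j)) z"
  using has_derivative_cnj[OF assms[unfolded has_wirtinger_def]]
  unfolding has_wirtinger_def
  by (rule has_derivative_eq_rhs) (simp add: fun_eq_iff add.commute)

lemma has_wirtinger_inverse:
  assumes "has_wirtinger f P Q z" "f z \<noteq> 0"
  shows "has_wirtinger (\<lambda>w. inverse (f w)) (\<lambda>j. - P j / (f z)\<^sup>2) (\<lambda>j. - Q j / (f z)\<^sup>2) z"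
  using Deriv.has_derivative_inverse[OF assms(2) assms(1)[unfolded has_wirtinger_def]]
  unfolding has_wirtinger_def
  by (rule has_derivative_eq_rhs)
    (auto simp: fun_eq_iff sum_distrib_left sum_distrib_right field_simps power2_eq_square
        add_divide_distrib
      simp flip: sum_negf intro!: sum.cong)

lemma has_wirtinger_ln:
  assumes w: "has_wirtinger (\<lambda>w. complex_of_real (g w)) P Q z" and pos: "g z > 0"
  shows "has_wirtinger (\<lambda>w. complex_of_real (ln (g w))) (\<lambda>j. P j / g z) (\<lambda>j. Q j / g z) z"
proof -
  let ?L = "\<lambda>h. \<Sum>j\<in>UNIV. P j * h $ j + Q j * cnj (h $ j)"
  have L: "((\<lambda>w. complex_of_real (g w)) has_derivative ?L) (at z)"
    using w by (simp add: has_wirtinger_def)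
  have "((\<lambda>w. Re (complex_of_real (g w))) has_derivative (\<lambda>h. Re (?L h))) (at z)"
    by (rule has_derivative_Re[OF L])
  then have g: "(g has_derivative (\<lambda>h. Re (?L h))) (at z)" by simp
  \<comment> \<open>The derivative of a real function is real; uniqueness of derivatives turns this
    into an identity for the complex linear form, which allows the chain rule for the real
    \<open>ln\<close>.\<close>
  have "((\<lambda>w. complex_of_real (g w)) has_derivative (\<lambda>h. complex_of_real (Re (?L h)))) (at z)"
    by (rule has_derivative_of_real[OF g])
  then have re: "?L = (\<lambda>h. complex_of_real (Re (?L h)))"
    by (rule has_derivative_unique[OF L])
  have "((\<lambda>w. ln (g w)) has_derivative (\<lambda>h. Re (?L h) / g z)) (at z)"
    using g pos by (auto intro!: derivative_eq_intros simp: divide_inverse)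
  from has_derivative_of_real[OF this, where ?'a = complex] show ?thesis
    unfolding has_wirtinger_def
  proof (rule has_derivative_eq_rhs)
    have "complex_of_real (Re (?L h) / g z) = ?L h / g z" for h
      using fun_cong[OF re, of h] by simp
    then show "(\<lambda>h. complex_of_real (Re (?L h) / g z))
      = (\<lambda>h. \<Sum>j\<in>UNIV. P j / g z * h $ j + Q j / g z * cnj (h $ j))"
      by (simp add: fun_eq_iff sum_divide_distrib add_divide_distrib)
  qed
qed

abbreviation holomorphic_at where
  "holomorphic_at f P z \<equiv> has_wirtinger f P (\<lambda>_. 0) z"

text \<open>The Fubini-Study computation. Here \<open>p i w\<close> is the gradient of
  \<open>f i\<close>. By holomorphy the barred derivative falls only on conjugated factors and the
  unbarred one only on the others; the second term comes from differentiating 1 / S.\<close>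

lemma ddbar_ln_sum_squares:
  fixes f :: "'i \<Rightarrow> complex^'n::finite \<Rightarrow> complex"
  assumes fin: "finite I"
    and f: "\<And>i w. i \<in> I \<Longrightarrow> holomorphic_at (f i) (p i w) w"
    and p: "\<And>i j w. i \<in> I \<Longrightarrow> \<exists>q. holomorphic_at (\<lambda>w. p i w j) q w"
    and pos: "\<And>w. (\<Sum>i\<in>I. (cmod (f i w))\<^sup>2) > 0"
  defines "S \<equiv> \<lambda>w. \<Sum>i\<in>I. f i w * cnj (f i w)"
  shows "ddbar (\<lambda>w. ln (\<Sum>i\<in>I. (cmod (f i w))\<^sup>2)) z $ j $ k =
    (\<Sum>i\<in>I. p i z j * cnj (p i z k)) / S z
     - (\<Sum>i\<in>I. p i z j * cnj (f i z)) * (\<Sum>i\<in>I. f i z * cnj (p i z k)) / (S z)\<^sup>2"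
proof -
  have S: "complex_of_real (\<Sum>i\<in>I. (cmod (f i w))\<^sup>2) = S w" for w
    by (simp add: S_def flip: complex_norm_square)
  have nz: "S w \<noteq> 0" for w using pos[of w] S[of w] by (metis less_irrefl of_real_eq_0_iff)
  have SW: "has_wirtinger S (\<lambda>j. \<Sum>i\<in>I. p i w j * cnj (f i w)) (\<lambda>j. \<Sum>i\<in>I. f i w * cnj (p i w j)) w" for w
    unfolding S_def
    using has_wirtinger_sum[OF has_wirtinger_mult[OF f has_wirtinger_cnj[OF f]]] by simp
  have "has_wirtinger (\<lambda>w. complex_of_real (ln (\<Sum>i\<in>I. (cmod (f i w))\<^sup>2)))
    (\<lambda>j. (\<Sum>i\<in>I. p i w j * cnj (f i w)) / S w) (\<lambda>j. (\<Sum>i\<in>I. f i w * cnj (p i w j)) / S w) w" for w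
    using has_wirtinger_ln[of "\<lambda>w. \<Sum>i\<in>I. (cmod (f i w))\<^sup>2"] SW[of w] pos[of w] unfolding S by blast
  then have wb: "wirt_bar k (\<lambda>w. complex_of_real (ln (\<Sum>i\<in>I. (cmod (f i w))\<^sup>2)))
      = (\<lambda>w. (\<Sum>i\<in>I. f i w * cnj (p i w k)) * inverse (S w))"
    using has_wirtinger_imp_wirt(2) by (fastforce simp: divide_inverse)
  have "\<forall>i\<in>I. \<exists>q. holomorphic_at (\<lambda>w. p i w k) q z" using p by blast
  from bchoice[OF this] obtain q where q: "\<And>i. i \<in> I \<Longrightarrow> holomorphic_at (\<lambda>w. p i w k) (q i) z"
    by blast
  \<comment> \<open>After conjugation the gradient \<open>q i\<close> of \<open>p i\<close> sits in
    the barred slot alone, so it does not enter the matrix entry.\<close>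
  have "has_wirtinger (\<lambda>w. \<Sum>i\<in>I. f i w * cnj (p i w k))
      (\<lambda>j. \<Sum>i\<in>I. f i z * cnj 0 + p i z j * cnj (p i z k))
      (\<lambda>j. \<Sum>i\<in>I. f i z * cnj (q i j) + 0 * cnj (p i z k)) z"
    by (rule has_wirtinger_sum) (rule has_wirtinger_mult[OF f has_wirtinger_cnj[OF q]])
  note w = has_wirtinger_mult[OF this has_wirtinger_inverse[OF SW nz]]
  have "ddbar (\<lambda>w. ln (\<Sum>i\<in>I. (cmod (f i w))\<^sup>2)) z $ j $ k
      = wirt j (\<lambda>w. (\<Sum>i\<in>I. f i w * cnj (p i w k)) * inverse (S w)) z"
    by (simp only: ddbar_def vec_lambda_beta wb)
  also have "\<dots> = (\<Sum>i\<in>I. p i z j * cnj (p i z k)) / S z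
     - (\<Sum>i\<in>I. p i z j * cnj (f i z)) * (\<Sum>i\<in>I. f i z * cnj (p i z k)) / (S z)\<^sup>2"
    unfolding has_wirtinger_imp_wirt(1)[OF w] by (simp add: divide_inverse mult_ac)
  finally show ?thesis .
qed

text \<open>Cauchy-Schwarz with a remainder. By Lagrange's identity the defect is half the sum of
  all squared 2x2 minors over I x I, where each unordered pair occurs twice; only the pair
  \<open>i\<close>, \<open>l\<close> is kept.\<close>

lemma lagrange_identity_le:
  fixes f g :: "'i \<Rightarrow> complex"
  assumes "finite I" "i \<in> I" "l \<in> I" "i \<noteq> l"
  shows "(cmod (f i * g l - f l * g i))\<^sup>2
    \<le> (\<Sum>i\<in>I. (cmod (g i))\<^sup>2) * (\<Sum>i\<in>I. (cmod (f i))\<^sup>2) - (cmod (\<Sum>i\<in>I. g i * cnj (f i)))\<^sup>2"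
proof -
  define T where "T = (\<lambda>(a, b). (cmod (f a * g b - f b * g a))\<^sup>2)"
  have T: "T (a, b) = (cmod (g b))\<^sup>2 * (cmod (f a))\<^sup>2 + (cmod (g a))\<^sup>2 * (cmod (f b))\<^sup>2
      - 2 * Re ((g b * cnj (f b)) * cnj (g a * cnj (f a)))" for a b
    unfolding T_def cmod_power2 by (simp add: power2_eq_square algebra_simps)
  have "(\<Sum>x\<in>I\<times>I. T x) = (\<Sum>a\<in>I. \<Sum>b\<in>I. T (a, b))"
    by (simp add: sum.cartesian_product)
  also have "\<dots> = 2 * ((\<Sum>i\<in>I. (cmod (g i))\<^sup>2) * (\<Sum>i\<in>I. (cmod (f i))\<^sup>2))
      - 2 * Re ((\<Sum>b\<in>I. g b * cnj (f b)) * cnj (\<Sum>a\<in>I. g a * cnj (f a)))"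
  proof -
    have 1: "(\<Sum>a\<in>I. \<Sum>b\<in>I. (cmod (g b))\<^sup>2 * (cmod (f a))\<^sup>2)
      = (\<Sum>i\<in>I. (cmod (g i))\<^sup>2) * (\<Sum>i\<in>I. (cmod (f i))\<^sup>2)"
      by (simp add: sum_product) (rule sum.swap)
    have 2: "(\<Sum>a\<in>I. \<Sum>b\<in>I. (cmod (g a))\<^sup>2 * (cmod (f b))\<^sup>2)
      = (\<Sum>i\<in>I. (cmod (g i))\<^sup>2) * (\<Sum>i\<in>I. (cmod (f i))\<^sup>2)"
      by (simp add: sum_product)
    have 3: "(\<Sum>a\<in>I. \<Sum>b\<in>I. (g b * cnj (f b)) * cnj (g a * cnj (f a)))
      = (\<Sum>b\<in>I. g b * cnj (f b)) * cnj (\<Sum>a\<in>I. g a * cnj (f a))"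
      unfolding cnj_sum sum_product by (rule sum.swap)
    show ?thesis
      unfolding T sum_subtractf sum.distrib 1 2 3[symmetric] by (simp add: sum_distrib_left)
  qed
  also have "(\<Sum>b\<in>I. g b * cnj (f b)) * cnj (\<Sum>a\<in>I. g a * cnj (f a))
      = complex_of_real ((cmod (\<Sum>i\<in>I. g i * cnj (f i)))\<^sup>2)"
    by (simp only: complex_norm_square)
  finally have sum: "(\<Sum>x\<in>I\<times>I. T x) = 2 * ((\<Sum>i\<in>I. (cmod (g i))\<^sup>2) * (\<Sum>i\<in>I. (cmod (f i))\<^sup>2)
      - (cmod (\<Sum>i\<in>I. g i * cnj (f i)))\<^sup>2)" by simp
  have "(\<Sum>x\<in>{(i,l),(l,i)}. T x) \<le> (\<Sum>x\<in>I\<times>I. T x)"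
    using assms by (intro sum_mono2) (auto simp: T_def)
  then show ?thesis using assms(4) unfolding sum by (simp add: T_def norm_minus_commute)
qed

definition form :: "complex^'n^'n::finite \<Rightarrow> complex^'n \<Rightarrow> real" where
  "form A v = Re (\<Sum>j\<in>UNIV. \<Sum>k\<in>UNIV. A $ j $ k * v $ j * cnj (v $ k))"

lemma form_add: "form (A + B) v = form A v + form B v"
  by (simp add: form_def sum.distrib algebra_simps)

text \<open>With \<open>g\<close> the derivative of \<open>f\<close> along \<open>v\<close>, the
  form equals (|g|^2 |f|^2 - |<g, f>|^2) / |f|^4, a Cauchy-Schwarz defect, which any single minor
  bounds from below.\<close>

lemma form_ddbar_ln_sum_squares:
  fixes f :: "'i \<Rightarrow> complex^'n::finite \<Rightarrow> complex" and z v :: "complex^'n"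
  assumes fin: "finite I"
    and f: "\<And>i w. i \<in> I \<Longrightarrow> holomorphic_at (f i) (p i w) w"
    and p: "\<And>i j w. i \<in> I \<Longrightarrow> \<exists>q. holomorphic_at (\<lambda>w. p i w j) q w"
    and pos: "\<And>w. (\<Sum>i\<in>I. (cmod (f i w))\<^sup>2) > 0"
    and il: "i \<in> I" "l \<in> I" "i \<noteq> l"
  defines "g \<equiv> \<lambda>i. \<Sum>j\<in>UNIV. p i z j * v $ j"
  shows "(cmod (f i z * g l - f l z * g i))\<^sup>2 / (\<Sum>i\<in>I. (cmod (f i z))\<^sup>2)\<^sup>2
    \<le> form (ddbar (\<lambda>w. ln (\<Sum>i\<in>I. (cmod (f i w))\<^sup>2)) z) v"
proof -
  define S where "S = (\<Sum>i\<in>I. (cmod (f i z))\<^sup>2)"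
  have Spos: "S > 0" using pos by (simp add: S_def)
  have S: "(\<Sum>i\<in>I. f i z * cnj (f i z)) = complex_of_real S"
    by (simp add: S_def flip: complex_norm_square)
  have lin: "(\<Sum>j\<in>UNIV. \<Sum>k\<in>UNIV. (\<Sum>i\<in>I. p i z j * cnj (p i z k)) * v $ j * cnj (v $ k))
      = (\<Sum>i\<in>I. g i * cnj (g i))" (is "?l = _")
  proof -
    have "?l = (\<Sum>j\<in>UNIV. \<Sum>k\<in>UNIV. \<Sum>i\<in>I. (p i z j * v $ j) * cnj (p i z k * v $ k))"
      by (simp add: sum_distrib_right sum_distrib_left mult_ac)
    also have "\<dots> = (\<Sum>j\<in>UNIV. \<Sum>i\<in>I. \<Sum>k\<in>UNIV. (p i z j * v $ j) * cnj (p i z k * v $ k))"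
      by (rule sum.cong[OF refl]) (rule sum.swap)
    also have "\<dots> = (\<Sum>i\<in>I. \<Sum>j\<in>UNIV. \<Sum>k\<in>UNIV. (p i z j * v $ j) * cnj (p i z k * v $ k))"
      by (rule sum.swap)
    finally show ?thesis by (simp only: g_def sum_product cnj_sum)
  qed
  define a where "a = (\<lambda>j. \<Sum>i\<in>I. p i z j * cnj (f i z))"
  have G: "(\<Sum>i\<in>I. g i * cnj (f i z)) = (\<Sum>j\<in>UNIV. a j * v $ j)"
    unfolding g_def a_def sum_distrib_right by (subst sum.swap) (simp add: mult_ac)
  have a_eq: "(\<Sum>i\<in>I. p i z j * cnj (f i z)) = a j" for j
    by (simp add: a_def)
  have cnj_a: "(\<Sum>i\<in>I. f i z * cnj (p i z k)) = cnj (a k)" for k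
    by (simp add: a_def mult.commute)
  have "(\<Sum>j\<in>UNIV. \<Sum>k\<in>UNIV. (a j * cnj (a k)) * v $ j * cnj (v $ k))
      = (\<Sum>i\<in>I. g i * cnj (f i z)) * cnj (\<Sum>i\<in>I. g i * cnj (f i z))"
    unfolding G cnj_sum sum_product by (simp add: mult_ac)
  note quad = this[folded complex_norm_square]
  have entry: "ddbar (\<lambda>w. ln (\<Sum>i\<in>I. (cmod (f i w))\<^sup>2)) z $ j $ k
      = (\<Sum>i\<in>I. p i z j * cnj (p i z k)) / S - a j * cnj (a k) / (complex_of_real S)\<^sup>2" for j k
    by (subst ddbar_ln_sum_squares[where f = f and p = p, OF fin f p pos])
      (simp_all only: S cnj_a a_eq)
  have "(\<Sum>j\<in>UNIV. \<Sum>k\<in>UNIV. ddbar (\<lambda>w. ln (\<Sum>i\<in>I. (cmod (f i w))\<^sup>2)) z $ j $ k * v $ j * cnj (v $ k))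
    = (\<Sum>i\<in>I. g i * cnj (g i)) / S
      - (\<Sum>j\<in>UNIV. \<Sum>k\<in>UNIV. (a j * cnj (a k)) * v $ j * cnj (v $ k)) / S\<^sup>2"
    unfolding entry lin[symmetric]
    by (simp add: left_diff_distrib sum_subtractf flip: sum_divide_distrib)
  also have "\<dots> = complex_of_real (\<Sum>i\<in>I. (cmod (g i))\<^sup>2) / S
      - complex_of_real ((cmod (\<Sum>i\<in>I. g i * cnj (f i z)))\<^sup>2) / S\<^sup>2"
    unfolding quad by (simp only: of_real_sum complex_norm_square)
  also have "\<dots> = complex_of_real
      (((\<Sum>i\<in>I. (cmod (g i))\<^sup>2) * S - (cmod (\<Sum>i\<in>I. g i * cnj (f i z)))\<^sup>2) / S\<^sup>2)"
  proof -
    have "complex_of_real X / S - complex_of_real Y / S\<^sup>2 = complex_of_real ((X * S - Y) / S\<^sup>2)" for X Y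
      using Spos by (simp add: field_simps power2_eq_square)
    then show ?thesis .
  qed
  finally have "form (ddbar (\<lambda>w. ln (\<Sum>i\<in>I. (cmod (f i w))\<^sup>2)) z) v
    = ((\<Sum>i\<in>I. (cmod (g i))\<^sup>2) * S - (cmod (\<Sum>i\<in>I. g i * cnj (f i z)))\<^sup>2) / S\<^sup>2"
    unfolding form_def by (simp only: Re_complex_of_real)
  moreover have "(cmod (f i z * g l - f l z * g i))\<^sup>2
    \<le> (\<Sum>i\<in>I. (cmod (g i))\<^sup>2) * S - (cmod (\<Sum>i\<in>I. g i * cnj (f i z)))\<^sup>2"
    unfolding S_def by (rule lagrange_identity_le[OF fin il, of "\<lambda>i. f i z" g])
  ultimately show ?thesis unfolding S_def[symmetric]
    by (simp add: divide_right_mono)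
qed


section \<open>Coordinates\<close>

text \<open>Numerals wrap around in these index types: the library's last index 3 (or 2) is the
  index 0 used for the first coordinate.\<close>

lemma UNIV_3_eq: "(UNIV :: 3 set) = {0, 1, 2}"
proof -
  have "(3::3) = 0" by simp
  then show ?thesis using UNIV_3 by (metis insert_commute)
qed

lemma UNIV_2_eq: "(UNIV :: 2 set) = {0, 1}"
proof -
  have "(2::2) = 0" by simp
  then show ?thesis using UNIV_2 by (metis insert_commute)
qed

lemma sum_UNIV_3: "(\<Sum>i\<in>UNIV. f (i::3)) = f 0 + f 1 + f 2" for f :: "3 \<Rightarrow> 'a::comm_monoid_add"
  unfolding UNIV_3_eq by (simp add: add.assoc)

lemma sum_UNIV_2: "(\<Sum>i\<in>UNIV. f (i::2)) = f 0 + f 1" for f :: "2 \<Rightarrow> 'a::comm_monoid_add"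
  unfolding UNIV_2_eq by simp

section \<open>Coordinate functions of the lifts as polynomials in 1, a, b, a b\<close>

type_synonym quad = "complex \<times> complex \<times> complex \<times> complex"

text \<open>Every homogeneous coordinate of the five lifts, dilated or not, has this shape, so one
  treatment serves all charts and all three projective factors.\<close>

definition bilin :: "quad \<Rightarrow> complex^2 \<Rightarrow> complex" where
  "bilin = (\<lambda>(c0, c1, c2, c3) z. c0 + c1 * z $ 0 + c2 * z $ 1 + c3 * (z $ 0 * z $ 1))"

definition bilin_deriv :: "quad \<Rightarrow> complex^2 \<Rightarrow> 2 \<Rightarrow> complex" where
  "bilin_deriv = (\<lambda>(c0, c1, c2, c3) z j. if j = 0 then c1 + c3 * z $ 1 else c2 + c3 * z $ 0)"

lemma holomorphic_at_bilin: "holomorphic_at (bilin q) (bilin_deriv q w) w"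
proof -
  obtain c0 c1 c2 c3 where q: "q = (c0, c1, c2, c3)" by (cases q)
  have "((\<lambda>z. c0 + c1 * z $ 0 + c2 * z $ 1 + c3 * (z $ 0 * z $ 1)) has_derivative
    (\<lambda>h. c1 * h $ 0 + c2 * h $ 1 + c3 * (w $ 0 * h $ 1 + h $ 0 * w $ 1))) (at w)"
    by (auto intro!: derivative_eq_intros bounded_linear_imp_has_derivative bounded_linear_vec_nth)
  then show ?thesis
    unfolding has_wirtinger_def q bilin_def
    by (simp add: bilin_deriv_def sum_UNIV_2) (erule has_derivative_eq_rhs, simp add: fun_eq_iff algebra_simps)
qed

lemma holomorphic_at_bilin_deriv: "\<exists>P. holomorphic_at (\<lambda>w. bilin_deriv q w j) P w"
proof -
  obtain c0 c1 c2 c3 where q: "q = (c0, c1, c2, c3)" by (cases q)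
  have "(\<lambda>w. bilin_deriv q w j) = (if j = 0 then bilin (c1, 0, c3, 0) else bilin (c2, c3, 0, 0))"
    by (auto simp: q bilin_deriv_def bilin_def)
  then show ?thesis using holomorphic_at_bilin by metis
qed

lemma elementary_Re_Im_bilin:
  "elementary (\<lambda>z. Re (bilin q z))" "elementary (\<lambda>z. Im (bilin q z))"
proof -
  define good where "good = (\<lambda>f :: complex^2 \<Rightarrow> complex. elementary (\<lambda>z. Re (f z)) \<and> elementary (\<lambda>z. Im (f z)))"
  have coord: "good (\<lambda>z. z $ j)" for j
    unfolding good_def
    by (auto intro!: elementary_linear bounded_linear_compose[OF bounded_linear_Re]
        bounded_linear_compose[OF bounded_linear_Im] bounded_linear_vec_nth)
  have const: "good (\<lambda>z. c)" for c
    unfolding good_def by (auto intro: elementary_const)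
  have add: "good (\<lambda>z. f z + g z)" if "good f" "good g" for f g
    using that unfolding good_def by (auto intro: elementary_add)
  have mult: "good (\<lambda>z. f z * g z)" if "good f" "good g" for f g
  proof -
    have "elementary (\<lambda>z. Re (f z) * Re (g z) + (-1) * (Im (f z) * Im (g z)))"
      using that unfolding good_def by (intro elementary_add elementary_mult elementary_const) auto
    moreover have "elementary (\<lambda>z. Re (f z) * Im (g z) + Im (f z) * Re (g z))"
      using that unfolding good_def by (intro elementary_add elementary_mult elementary_const) auto
    ultimately show ?thesis unfolding good_def by simp
  qed
  have "good (bilin q)"
    unfolding bilin_def by (cases q) (auto intro!: add mult const coord)
  then show "elementary (\<lambda>z. Re (bilin q z))" "elementary (\<lambda>z. Im (bilin q z))"
    by (auto simp: good_def)
qed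

definition ln_norm :: "('i::finite \<Rightarrow> quad) \<Rightarrow> complex^2 \<Rightarrow> real" where
  "ln_norm c = (\<lambda>w. ln (\<Sum>i\<in>UNIV. (cmod (bilin (c i) w))\<^sup>2))"

(* Guarantees a positive sum of squares; every lift has a coordinate equal to 1. *)
definition nondegenerate :: "('i::finite \<Rightarrow> quad) \<Rightarrow> bool" where
  "nondegenerate c \<longleftrightarrow> (\<exists>i d. d \<noteq> 0 \<and> c i = (d, 0, 0, 0))"

lemma nondegenerate_pos:
  fixes c :: "'i::finite \<Rightarrow> quad"
  assumes "nondegenerate c"
  shows "(\<Sum>i\<in>UNIV. (cmod (bilin (c i) w))\<^sup>2) > 0"
proof -
  obtain i d where "d \<noteq> 0" "c i = (d, 0, 0, 0)" using assms by (auto simp: nondegenerate_def)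
  then have "0 < (cmod (bilin (c i) w))\<^sup>2" by (simp add: bilin_def)
  then show ?thesis by (intro sum_pos2[of _ i]) auto
qed

lemma elementary_sum:
  "finite I \<Longrightarrow> (\<And>i. i \<in> I \<Longrightarrow> elementary (f i)) \<Longrightarrow> elementary (\<lambda>x. \<Sum>i\<in>I. f i x)"
  by (induction I rule: finite_induct) (auto intro: elementary_add elementary_const)

lemma elementary_ln_norm:
  assumes "nondegenerate c"
  shows "elementary (ln_norm c)"
  unfolding ln_norm_def
proof (rule elementary_ln[OF elementary_sum])
  fix i
  show "elementary (\<lambda>w. (cmod (bilin (c i) w))\<^sup>2)"
    unfolding cmod_power2 unfolding power2_eq_square
    by (intro elementary_add elementary_mult elementary_Re_Im_bilin)
qed (use nondegenerate_pos[OF assms] in auto)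

lemma form_ln_norm:
  fixes c :: "'i::finite \<Rightarrow> quad" and z v :: "complex^2"
  assumes "nondegenerate c" "i \<noteq> l"
  defines "g \<equiv> \<lambda>i. \<Sum>j\<in>UNIV. bilin_deriv (c i) z j * v $ j"
  shows "(cmod (bilin (c i) z * g l - bilin (c l) z * g i))\<^sup>2
      / (\<Sum>i\<in>UNIV. (cmod (bilin (c i) z))\<^sup>2)\<^sup>2 \<le> form (ddbar (ln_norm c) z) v"
  unfolding g_def ln_norm_def
  by (rule form_ddbar_ln_sum_squares)
    (use assms holomorphic_at_bilin holomorphic_at_bilin_deriv nondegenerate_pos in auto)

text \<open>The inequality in the hypothesis says that the ratio of the coordinates \<open>i\<close>
  and \<open>l\<close> moves to first order in the direction \<open>v\<close>; one such minor makes
  the form strictly positive.\<close>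

lemma form_ln_norm_pos:
  assumes "nondegenerate c" "i \<noteq> l"
    and "bilin (c i) z * (\<Sum>j\<in>UNIV. bilin_deriv (c l) z j * v $ j)
       \<noteq> bilin (c l) z * (\<Sum>j\<in>UNIV. bilin_deriv (c i) z j * v $ j)"
  shows "form (ddbar (ln_norm c) z) v > 0"
  by (rule less_le_trans[OF _ form_ln_norm[OF assms(1,2)]])
    (use assms(3) nondegenerate_pos[OF assms(1), of z] in simp)

lemma form_ln_norm_nonneg:
  assumes "nondegenerate c" "\<exists>i l :: 'i::finite. i \<noteq> l"
  shows "form (ddbar (ln_norm (c :: 'i \<Rightarrow> quad)) z) v \<ge> 0"
proof -
  obtain i l :: 'i where "i \<noteq> l" using assms(2) by blast
  then show ?thesis by (intro order.trans[OF _ form_ln_norm[OF assms(1)]]) auto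
qed

section \<open>Dilations and positivity of the pulled back forms\<close>

definition dilate :: "real \<Rightarrow> complex^'n::{finite,zero} \<Rightarrow> complex^'n::{finite,zero}" where
  "dilate r v = (\<chi> i. if i = 0 then v $ i else complex_of_real r * v $ i)"

text \<open>Coordinate 0 is fixed in each factor and all others are scaled, which preserves both
  incidence equations and reads (a, b) to (r a, r b) in the torus chart.\<close>

definition dilate_coords :: "real \<Rightarrow> hcoords \<Rightarrow> hcoords" where
  "dilate_coords r = (\<lambda>(Z, X, Y). (dilate r Z, dilate r X, dilate r Y))"

lemma dilate_1: "dilate_coords 1 W = W"
  by (cases W) (simp add: dilate_coords_def dilate_def vec_eq_iff)

definition triple :: "'a \<Rightarrow> 'a \<Rightarrow> 'a \<Rightarrow> 3 \<Rightarrow> 'a" where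
  "triple a b c i = (if i = 0 then a else if i = 1 then b else c)"

definition pair :: "'a \<Rightarrow> 'a \<Rightarrow> 2 \<Rightarrow> 'a" where
  "pair a b i = (if i = 0 then a else b)"

lemma triple_simps [simp]: "triple a b c 0 = a" "triple a b c 1 = b" "triple a b c 2 = c"
  by (simp_all add: triple_def)

lemma pair_simps [simp]: "pair a b 0 = a" "pair a b 1 = b"
  by (simp_all add: pair_def)

(* Coefficients, in the basis 1, a, b, a b, of the homogeneous coordinates of the dilated lifts. *)
definition coefs :: "real \<Rightarrow> ((3 \<Rightarrow> quad) \<times> (2 \<Rightarrow> quad) \<times> (2 \<Rightarrow> quad)) list" where
  "coefs r = (let r = complex_of_real r in
    [(triple (1,0,0,0) (0,r,0,0) (0,0,r,0), pair (1,0,0,0) (0,r,0,0), pair (1,0,0,0) (0,0,r,0)),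
     (triple (0,1,0,0) (r,0,0,0) (0,0,0,r), pair (0,1,0,0) (r,0,0,0), pair (1,0,0,0) (0,0,r,0)),
     (triple (0,0,0,1) (r,0,0,0) (0,0,r,0), pair (0,0,0,1) (r,0,0,0), pair (0,1,0,0) (r,0,0,0)),
     (triple (0,1,0,0) (0,0,0,r) (r,0,0,0), pair (1,0,0,0) (0,0,r,0), pair (0,1,0,0) (r,0,0,0)),
     (triple (0,0,0,1) (0,0,r,0) (r,0,0,0), pair (0,1,0,0) (r,0,0,0), pair (0,0,0,1) (r,0,0,0))])"

lemma log_norms_dilate:
  assumes "k < length lifts"
  shows "log_norms (dilate_coords r ((lifts ! k) w)) =
    ln_norm (fst (coefs r ! k)) w + ln_norm (fst (snd (coefs r ! k))) w
      + ln_norm (snd (snd (coefs r ! k))) w"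
  using assms unfolding length_lifts less_5
  by (elim disjE; simp only: lift_simps)
    (simp_all add: log_norms_def dilate_coords_def dilate_def coefs_def Let_def
      ln_norm_def bilin_def sum_UNIV_2 sum_UNIV_3)

lemma nondegenerate_coefs:
  assumes "k < length lifts" "r \<noteq> 0"
  shows "nondegenerate (fst (coefs r ! k))" "nondegenerate (fst (snd (coefs r ! k)))"
    "nondegenerate (snd (snd (coefs r ! k)))"
proof -
  have t: "nondegenerate (triple a b c)" if "\<exists>d. d \<noteq> 0 \<and> (a = (d,0,0,0) \<or> b = (d,0,0,0) \<or> c = (d,0,0,0))" for a b c
    using that unfolding nondegenerate_def by (metis triple_simps)
  have p: "nondegenerate (pair a b)" if "\<exists>d. d \<noteq> 0 \<and> (a = (d,0,0,0) \<or> b = (d,0,0,0))" for a b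
    using that unfolding nondegenerate_def by (metis pair_simps)
  show "nondegenerate (fst (coefs r ! k))" "nondegenerate (fst (snd (coefs r ! k)))"
    "nondegenerate (snd (snd (coefs r ! k)))"
    using assms unfolding length_lifts less_5
    by (elim disjE; force intro!: t p simp: coefs_def Let_def)+
qed

lemma elementary_log_norms_dilate:
  assumes "k < length lifts" "r \<noteq> 0"
  shows "elementary (\<lambda>w. log_norms (dilate_coords r ((lifts ! k) w)))"
  unfolding log_norms_dilate[OF assms(1)]
  by (intro elementary_add elementary_ln_norm nondegenerate_coefs assms)

lemma twice_differentiable_elementary: "elementary f \<Longrightarrow> twice_differentiable f"
  by (intro smooth_imp_twice_differentiable smooth_elementary)

lemma ddbar_log_norms_dilate:
  assumes "k < length lifts" "r \<noteq> 0"
  shows "ddbar (\<lambda>w. log_norms (dilate_coords r ((lifts ! k) w))) z =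
    ddbar (ln_norm (fst (coefs r ! k))) z + ddbar (ln_norm (fst (snd (coefs r ! k)))) z
      + ddbar (ln_norm (snd (snd (coefs r ! k)))) z"
  unfolding log_norms_dilate[OF assms(1)]
  by (simp add: ddbar_add twice_differentiable_add twice_differentiable_elementary
      elementary_ln_norm nondegenerate_coefs[OF assms])

lemma ex_distinct: "\<exists>i l :: 3. i \<noteq> l" "\<exists>i l :: 2. i \<noteq> l"
  by (metis zero_neq_one)+

text \<open>The form is a sum of three semidefinite Fubini-Study pullbacks, so it suffices that one
  of them is positive on each \<open>v\<close>. For r = 1 this is the positivity of
  \<open>omega\<close>.\<close>

lemma pos_form_ddbar_log_norms_dilate:
  assumes k: "k < length lifts" and r: "r \<noteq> 0"
  shows "pos_form (ddbar (\<lambda>w. log_norms (dilate_coords r ((lifts ! k) w))) z)"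
proof -
  let ?A = "\<lambda>c. form (ddbar (ln_norm c) z)"
  have "0 < ?A (fst (coefs r ! k)) v + ?A (fst (snd (coefs r ! k))) v + ?A (snd (snd (coefs r ! k))) v"
    if "v \<noteq> 0" for v
  proof -
    note nn = form_ln_norm_nonneg[OF nondegenerate_coefs(1)[OF k r] ex_distinct(1), of z v]
      form_ln_norm_nonneg[OF nondegenerate_coefs(2)[OF k r] ex_distinct(2), of z v]
      form_ln_norm_nonneg[OF nondegenerate_coefs(3)[OF k r] ex_distinct(2), of z v]
    have v: "v $ 0 \<noteq> 0 \<or> v $ 1 \<noteq> 0" using that by (auto simp: vec2_eq_iff)
    have "?A (fst (coefs r ! k)) v > 0 \<or> ?A (fst (snd (coefs r ! k))) v > 0
        \<or> ?A (snd (snd (coefs r ! k))) v > 0"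
    proof -
      \<comment> \<open>These minors cover every chart. In charts 0, 1 and 3 the factors X and Y
        together detect both components of \<open>v\<close>; in charts 2 and 4 one of them detects
        \<open>v $ 0\<close>, and the minor of Z_1 and Z_2 detects \<open>v $ 1\<close> even where a
        = 0.\<close>
      note pos = form_ln_norm_pos[OF nondegenerate_coefs(1)[OF k r], of 1 2 z v]
        form_ln_norm_pos[OF nondegenerate_coefs(2)[OF k r], of 0 1 z v]
        form_ln_norm_pos[OF nondegenerate_coefs(3)[OF k r], of 0 1 z v]
      from k show ?thesis unfolding length_lifts less_5
        by (elim disjE; insert pos v r)
          (auto simp: coefs_def Let_def bilin_def bilin_deriv_def sum_UNIV_2 algebra_simps)
    qed
    with nn show ?thesis by linarith
  qed
  then show ?thesis
    unfolding pos_form_def form_def[symmetric] ddbar_log_norms_dilate[OF k r] form_add by blast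
qed

text \<open>Since |a|^2 = P - 1 and |b|^2 = Q - 1, the diagonal entries collapse to Q / S^2 + 1 /
  P^2 and P / S^2 + 1 / Q^2. The CP^2 part of the determinant is (P Q - (P - 1) (Q - 1)) / S^4 = 1 /
  S^3.\<close>

lemma det_omega_0:
  fixes z :: "complex^2"
  defines "P \<equiv> 1 + (cmod (z $ 0))\<^sup>2" and "Q \<equiv> 1 + (cmod (z $ 1))\<^sup>2"
  defines "S \<equiv> P + Q - 1"
  shows "Re (det (omega 0 z)) = 1 / S ^ 3 + 1 / (S\<^sup>2 * P) + 1 / (S\<^sup>2 * Q) + 1 / (P\<^sup>2 * Q\<^sup>2)"
proof -
  define a b where "a = z $ 0" and "b = z $ 1"
  have pos: "P > 0" "Q > 0" "S > 0"
    by (auto simp: P_def Q_def S_def intro: add_pos_nonneg)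
  have k: "0 < length lifts" by (simp add: length_lifts)
  have entry: "ddbar (ln_norm c) z $ j $ k =
      (\<Sum>i\<in>UNIV. bilin_deriv (c i) z j * cnj (bilin_deriv (c i) z k)) / (\<Sum>i\<in>UNIV. bilin (c i) z * cnj (bilin (c i) z))
     - (\<Sum>i\<in>UNIV. bilin_deriv (c i) z j * cnj (bilin (c i) z)) * (\<Sum>i\<in>UNIV. bilin (c i) z * cnj (bilin_deriv (c i) z k))
       / (\<Sum>i\<in>UNIV. bilin (c i) z * cnj (bilin (c i) z))\<^sup>2"
    if "nondegenerate c" for c :: "'i::finite \<Rightarrow> quad" and j k
    unfolding ln_norm_def
    by (rule ddbar_ln_sum_squares)
      (use that holomorphic_at_bilin holomorphic_at_bilin_deriv nondegenerate_pos in auto)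
  have om: "omega 0 z = ddbar (ln_norm (fst (coefs 1 ! 0))) z + ddbar (ln_norm (fst (snd (coefs 1 ! 0)))) z
      + ddbar (ln_norm (snd (snd (coefs 1 ! 0)))) z"
    using ddbar_log_norms_dilate[OF k, of 1 z] by (simp add: omega_def dilate_1)
  have PQ: "complex_of_real P = 1 + a * cnj a" "complex_of_real Q = 1 + b * cnj b"
    by (simp_all add: P_def Q_def a_def b_def flip: complex_norm_square)
  have S: "complex_of_real S = 1 + a * cnj a + b * cnj b"
    by (simp add: S_def PQ)
  have "nondegenerate (triple (1,0,0,0) (0,1,0,0) (0,0,1,0))"
    "nondegenerate (pair (1,0,0,0) (0,1,0,0))" "nondegenerate (pair (1,0,0,0) (0,0,1,0))"
    using nondegenerate_coefs[OF k, of 1] by (simp_all add: coefs_def Let_def)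
  note e = this[THEN entry]
  note ents = om e coefs_def Let_def bilin_def bilin_deriv_def sum_UNIV_2 sum_UNIV_3 PQ S
    a_def[symmetric] b_def[symmetric]
  have "omega 0 z $ 0 $ 0 = 1 / S - a * cnj a / S\<^sup>2 + (1 / P - a * cnj a / P\<^sup>2)"
    by (simp add: ents mult_ac)
  moreover have "omega 0 z $ 1 $ 1 = 1 / S - b * cnj b / S\<^sup>2 + (1 / Q - b * cnj b / Q\<^sup>2)"
    by (simp add: ents mult_ac)
  moreover have od: "omega 0 z $ 0 $ 1 = - (b * cnj a) / S\<^sup>2" "omega 0 z $ 1 $ 0 = - (a * cnj b) / S\<^sup>2"
    by (simp_all add: ents mult_ac)
  moreover have "a * cnj a = P - 1" "b * cnj b = Q - 1" by (simp_all add: PQ)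
  moreover have "1 / complex_of_real x - (y - 1) / (complex_of_real x)\<^sup>2
      = (complex_of_real x - y + 1) / (complex_of_real x)\<^sup>2" if "x > 0" for x and y :: complex
    using that by (simp add: field_simps power2_eq_square)
  moreover have "complex_of_real S - P + 1 = Q" "complex_of_real S - Q + 1 = P"
    by (simp_all add: S_def)
  ultimately have ent: "omega 0 z $ 0 $ 0 = Q / S\<^sup>2 + 1 / P\<^sup>2" "omega 0 z $ 1 $ 1 = P / S\<^sup>2 + 1 / Q\<^sup>2"
    using pos by (simp_all add: power_eq_if)
  have off: "omega 0 z $ 0 $ 1 * omega 0 z $ 1 $ 0 = (a * cnj a) * (b * cnj b) / S ^ 4"
    unfolding od by (simp add: power_eq_if mult_ac)
  have off: "omega 0 z $ 0 $ 1 * omega 0 z $ 1 $ 0 = (P - 1) * (Q - 1) / S ^ 4"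
    unfolding off by (simp add: PQ)
  have "(2::2) = 0" by simp
  then have "det (omega 0 z) = omega 0 z $ 0 $ 0 * omega 0 z $ 1 $ 1 - omega 0 z $ 0 $ 1 * omega 0 z $ 1 $ 0"
    using det_2[of "omega 0 z"] by (metis mult.commute)
  also have "\<dots> = complex_of_real ((Q / S\<^sup>2 + 1 / P\<^sup>2) * (P / S\<^sup>2 + 1 / Q\<^sup>2) - (P - 1) * (Q - 1) / S ^ 4)"
    unfolding ent off by simp
  finally have "Re (det (omega 0 z)) = (Q / S\<^sup>2 + 1 / P\<^sup>2) * (P / S\<^sup>2 + 1 / Q\<^sup>2) - (P - 1) * (Q - 1) / S ^ 4"
    by simp
  also have "\<dots> = (P * Q - (P - 1) * (Q - 1)) / S ^ 4 + 1 / (S\<^sup>2 * P) + 1 / (S\<^sup>2 * Q) + 1 / (P\<^sup>2 * Q\<^sup>2)"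
    using pos by (simp add: divide_simps) algebra
  also have "P * Q - (P - 1) * (Q - 1) = S" by (simp add: S_def algebra_simps)
  also have "S / S ^ 4 = 1 / S ^ 3" using pos by (simp add: divide_simps power_eq_if)
  finally show ?thesis .
qed


section \<open>The weight of the volume form on the torus chart\<close>

text \<open>The exponential of the potential of \<open>omega\<close> in the torus chart. As
  \<open>omega\<close> represents the first Chern class, the density of omega^2 is comparable to the
  reciprocal of \<open>weight\<close>.\<close>

definition weight :: "complex^2 \<Rightarrow> real" where
  "weight z = (1 + (cmod (z $ 0))\<^sup>2 + (cmod (z $ 1))\<^sup>2) * (1 + (cmod (z $ 0))\<^sup>2) * (1 + (cmod (z $ 1))\<^sup>2)"

lemma weight_ge_1: "weight z \<ge> 1"
proof -
  have "1 * 1 * 1 \<le> weight z" unfolding weight_def by (intro mult_mono) auto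
  then show ?thesis by simp
qed

lemma weight_pos: "weight z > 0"
  using weight_ge_1[of z] by linarith

lemma log_norms_lift_0: "log_norms ((lifts ! 0) z) = ln (weight z)"
proof -
  have pos: "1 + (cmod a)\<^sup>2 + (cmod b)\<^sup>2 > 0" "1 + (cmod a)\<^sup>2 > 0" for a b
    by (auto intro!: add_pos_nonneg)
  show ?thesis
    using pos(1)[of "z $ 0" "z $ 1"] pos(2)[of "z $ 0"] pos(2)[of "z $ 1"]
    by (simp add: lift_simps lift_simps[simplified] log_norms_def sum_UNIV_2 sum_UNIV_3 weight_def ln_mult)
qed

lemma log_norms_dilate_lift_0:
  "log_norms (dilate_coords r ((lifts ! 0) z)) = ln (weight (r *\<^sub>R z))"
proof -
  have "dilate_coords r ((lifts ! 0) z) = (lifts ! 0) (r *\<^sub>R z)"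
    unfolding lift_simps
    by (simp add: dilate_coords_def dilate_def vec3_eq_iff vec2_eq_iff
        scaleR_conv_of_real[where ?'a = complex])
  then show ?thesis by (simp add: log_norms_lift_0)
qed

text \<open>From P, Q \<le> S \<le> P Q each of the four terms of the determinant is at most 1 / (S
  P Q). The two mixed terms alone add up to (P + Q) / (S * weight), and P + Q = S + 1 exceeds
  S.\<close>

lemma det_omega_0_bounds:
  "1 / weight z \<le> Re (det (omega 0 z))" "Re (det (omega 0 z)) \<le> 4 / weight z"
proof -
  define P Q where "P = 1 + (cmod (z $ 0))\<^sup>2" and "Q = 1 + (cmod (z $ 1))\<^sup>2"
  define S where "S = P + Q - 1"
  have det: "Re (det (omega 0 z)) = 1 / S ^ 3 + 1 / (S\<^sup>2 * P) + 1 / (S\<^sup>2 * Q) + 1 / (P\<^sup>2 * Q\<^sup>2)"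
    unfolding P_def Q_def S_def by (rule det_omega_0)
  have W: "weight z = S * P * Q" by (simp add: weight_def S_def P_def Q_def algebra_simps)
  have ge: "P \<ge> 1" "Q \<ge> 1" by (auto simp: P_def Q_def)
  then have S: "P \<le> S" "Q \<le> S" "S \<ge> 1" by (auto simp: S_def)
  have SPQ: "S \<le> P * Q"
  proof -
    have "0 \<le> (P - 1) * (Q - 1)" using ge by simp
    then show ?thesis by (simp add: S_def algebra_simps)
  qed
  have pos: "P > 0" "Q > 0" "S > 0" using ge S by linarith+
  have "1 / S ^ 3 \<le> 1 / weight z"
  proof (rule divide_left_mono)
    show "weight z \<le> S ^ 3" unfolding W power3_eq_cube
      using S pos by (intro mult_mono) auto
  qed (use pos weight_pos in auto)
  moreover have "1 / (S\<^sup>2 * P) \<le> 1 / weight z"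
  proof (rule divide_left_mono)
    have "S * P * Q \<le> S * P * S" using S pos by (intro mult_left_mono) auto
    then show "weight z \<le> S\<^sup>2 * P" by (simp add: W power2_eq_square mult_ac)
  qed (use pos weight_pos in auto)
  moreover have "1 / (S\<^sup>2 * Q) \<le> 1 / weight z"
  proof (rule divide_left_mono)
    have "S * Q * P \<le> S * Q * S" using S pos by (intro mult_left_mono) auto
    then show "weight z \<le> S\<^sup>2 * Q" by (simp add: W power2_eq_square mult_ac)
  qed (use pos weight_pos in auto)
  moreover have "1 / (P\<^sup>2 * Q\<^sup>2) \<le> 1 / weight z"
  proof (rule divide_left_mono)
    have "S * (P * Q) \<le> (P * Q) * (P * Q)" using SPQ pos by (intro mult_right_mono) auto
    then show "weight z \<le> P\<^sup>2 * Q\<^sup>2" by (simp add: W power2_eq_square mult_ac)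
  qed (use pos weight_pos in auto)
  ultimately show "Re (det (omega 0 z)) \<le> 4 / weight z" unfolding det by simp
  have "1 / weight z \<le> (P + Q) / (S * weight z)"
    using pos weight_pos[of z] by (simp add: divide_simps) (simp add: S_def)
  also have "\<dots> = 1 / (S\<^sup>2 * P) + 1 / (S\<^sup>2 * Q)"
    using pos by (simp add: W field_simps power2_eq_square)
  also have "\<dots> \<le> Re (det (omega 0 z))" unfolding det using pos by simp
  finally show "1 / weight z \<le> Re (det (omega 0 z))" .
qed

section \<open>Invariance under the symmetry group\<close>

lemma sym_group_invariant:
  assumes gen: "\<And>g p. g \<in> sym_gens \<Longrightarrow> p \<in> surface \<Longrightarrow> \<phi> (g p) = \<phi> p"
    and g: "g \<in> sym_group"
  shows "p \<in> surface \<Longrightarrow> \<phi> (g p) = \<phi> p"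
proof -
  \<comment> \<open>Membership in \<open>Bij surface\<close> is carried through the induction
    because multiplication and inversion in \<open>BijGroup\<close> have their expected values only
    for bijections of the surface.\<close>
  have "g \<in> Bij surface \<and> (\<forall>p\<in>surface. \<phi> (g p) = \<phi> p)"
    using g unfolding sym_group_def
  proof (induction rule: generate.induct)
    case one
    then show ?case using id_Bij[of surface] by (simp add: BijGroup_def restrict_def)
  next
    case (incl h)
    then show ?case using gen sym_gens_bij by (auto simp: BijGroup_def)
  next
    case (inv h)
    then have h: "h \<in> Bij surface" using sym_gens_bij by (auto simp: BijGroup_def)
    have "\<phi> (inv_into surface h p) = \<phi> p" if "p \<in> surface" for p
    proof -
      have "inv_into surface h p \<in> surface" "h (inv_into surface h p) = p"
        using h that by (auto simp: Bij_def bij_betw_def inv_into_into f_inv_into_f)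
      then show ?thesis using gen[OF inv] by metis
    qed
    then show ?case 
      using restrict_inv_into_Bij[OF h] by (simp add: inv_BijGroup[OF h] restrict_def)
  next
    case (eng g h)
    then have "h p \<in> surface" if "p \<in> surface" for p
      using that Bij_imp_funcset[of h surface] by blast
    with eng show ?case by (simp add: BijGroup_def compose_Bij compose_eq)
  qed
  then show "p \<in> surface \<Longrightarrow> \<phi> (g p) = \<phi> p" by blast
qed


section \<open>Potentials of the pullbacks under dilations\<close>

text \<open>A function on projective space: another representative multiplies both norms by the same
  factor, so the choice made by \<open>SOME\<close> is immaterial for nonzero vectors.\<close>

definition norm_ratio :: "real \<Rightarrow> (complex^'n::{finite,zero}) set \<Rightarrow> real" where
  "norm_ratio r L = (let v = SOME v. v \<in> L in
     ln (\<Sum>i\<in>UNIV. (cmod (dilate r v $ i))\<^sup>2) - ln (\<Sum>i\<in>UNIV. (cmod (v $ i))\<^sup>2))"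

lemma sum_norm_pos:
  fixes v :: "complex^'n::finite"
  assumes "v \<noteq> 0"
  shows "(\<Sum>i\<in>UNIV. (cmod (v $ i))\<^sup>2) > 0"
proof -
  obtain i where "v $ i \<noteq> 0" using assms by (auto simp: vec_eq_iff)
  then show ?thesis by (intro sum_pos2[of _ i]) auto
qed

lemma dilate_eq_0_iff: "r \<noteq> 0 \<Longrightarrow> dilate r v = 0 \<longleftrightarrow> v = 0"
  by (auto simp: dilate_def vec_eq_iff split: if_splits)

lemma norm_ratio_hclass:
  fixes v :: "complex^'n::{finite,zero}"
  assumes "v \<noteq> 0" "r \<noteq> 0"
  shows "norm_ratio r (hclass v) =
     ln (\<Sum>i\<in>UNIV. (cmod (dilate r v $ i))\<^sup>2) - ln (\<Sum>i\<in>UNIV. (cmod (v $ i))\<^sup>2)"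
proof -
  define u where "u = (SOME u. u \<in> hclass v)"
  have "1 *s v \<in> hclass v" unfolding hclass_def by (auto intro!: exI[of _ 1])
  then have "u \<in> hclass v" unfolding u_def by (rule someI)
  then obtain c where c: "c \<noteq> 0" "u = c *s v" by (auto simp: hclass_def)
  have "(\<Sum>i\<in>UNIV. (cmod (u $ i))\<^sup>2) = (cmod c)\<^sup>2 * (\<Sum>i\<in>UNIV. (cmod (v $ i))\<^sup>2)"
    by (simp add: c norm_mult power_mult_distrib sum_distrib_left)
  moreover have "dilate r u = c *s dilate r v"
    by (simp add: c dilate_def vec_eq_iff)
  then have "(\<Sum>i\<in>UNIV. (cmod (dilate r u $ i))\<^sup>2) = (cmod c)\<^sup>2 * (\<Sum>i\<in>UNIV. (cmod (dilate r v $ i))\<^sup>2)"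
    by (simp add: norm_mult power_mult_distrib sum_distrib_left)
  moreover have "(\<Sum>i\<in>UNIV. (cmod (v $ i))\<^sup>2) > 0" "(\<Sum>i\<in>UNIV. (cmod (dilate r v $ i))\<^sup>2) > 0"
    using assms by (simp_all add: sum_norm_pos dilate_eq_0_iff)
  ultimately show ?thesis
    unfolding norm_ratio_def u_def[symmetric] Let_def using c(1) by (simp add: ln_mult)
qed

(* The difference of the potentials of omega pulled back by the dilation and of omega. *)
definition dilation_potential :: "real \<Rightarrow> point \<Rightarrow> real" where
  "dilation_potential r = (\<lambda>(L, P, Q). norm_ratio r L + norm_ratio r P + norm_ratio r Q)"

lemma dilation_potential_to_point:
  assumes "Z \<noteq> 0" "X \<noteq> 0" "Y \<noteq> 0" "r \<noteq> 0"
  shows "dilation_potential r (to_point (Z, X, Y))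
    = log_norms (dilate_coords r (Z, X, Y)) - log_norms (Z, X, Y)"
  using assms
  by (simp add: dilation_potential_def to_point_def norm_ratio_hclass log_norms_def dilate_coords_def)

lemma lift_nonzero:
  assumes "k < length lifts" "(lifts ! k) z = (Z, X, Y)"
  shows "Z \<noteq> 0" "X \<noteq> 0" "Y \<noteq> 0"
  using assms unfolding length_lifts less_5
  by (elim disjE; simp only: lift_simps; auto simp: vec3_eq_iff vec2_eq_iff)+

lemma dilation_potential_chart:
  assumes "k < length lifts" "r \<noteq> 0"
  shows "dilation_potential r (chart k z)
    = log_norms (dilate_coords r ((lifts ! k) z)) - log_norms ((lifts ! k) z)"
  by (cases "(lifts ! k) z")
    (use lift_nonzero[OF assms(1)] dilation_potential_to_point assms in \<open>auto simp: chart_def\<close>)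

lemma sum_norm_mult_coord:
  fixes v :: "complex^'n::{finite,zero}"
  assumes "cmod c = 1"
  shows "(\<Sum>i\<in>UNIV. (cmod (mult_coord j c v $ i))\<^sup>2) = (\<Sum>i\<in>UNIV. (cmod (v $ i))\<^sup>2)"
    "(\<Sum>i\<in>UNIV. (cmod (dilate r (mult_coord j c v) $ i))\<^sup>2) = (\<Sum>i\<in>UNIV. (cmod (dilate r v $ i))\<^sup>2)"
  using assms by (auto intro!: sum.cong simp: mult_coord_def dilate_def norm_mult)

lemma mult_coord_nonzero:
  fixes v :: "complex^'n::finite"
  assumes "c \<noteq> 0" "v \<noteq> 0"
  shows "mult_coord j c v \<noteq> 0"
  using assms by (auto simp: mult_coord_def vec_eq_iff split: if_splits)

lemma dilation_potential_sym_gens: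
  assumes "r \<noteq> 0" "g \<in> sym_gens" "p \<in> surface"
  shows "dilation_potential r (g p) = dilation_potential r p"
proof -
  obtain Z X Y where p: "p = to_point (Z, X, Y)" and nz: "Z \<noteq> 0" "X \<noteq> 0" "Y \<noteq> 0"
    using assms(3) unfolding surface_def by blast
  have nz3: "vec3 (Z $ 0) (Z $ 2) (Z $ 1) \<noteq> 0" using nz by (auto simp: vec3_eq_iff)
  have "dilation_potential r (rot0 \<theta> p) = dilation_potential r p"
    "dilation_potential r (rot1 \<theta> p) = dilation_potential r p"
    "dilation_potential r (rot2 \<theta> p) = dilation_potential r p" for \<theta>
    unfolding p gens_to_point using nz assms(1)
    by (simp_all add: dilation_potential_to_point mult_coord_nonzero log_norms_def dilate_coords_def
        sum_norm_mult_coord)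
  moreover have "dilation_potential r (flip p) = dilation_potential r p"
    unfolding p gens_to_point using nz nz3 assms(1)
    by (simp add: dilation_potential_to_point log_norms_def dilate_coords_def dilate_def sum_UNIV_3 add_ac)
  ultimately show ?thesis using assms(2,3) by (auto simp: sym_gens_def)
qed

lemma norm_ratio_le_0:
  assumes "v \<noteq> 0" "0 < r" "r \<le> 1"
  shows "norm_ratio r (hclass v) \<le> 0"
proof -
  have "(\<Sum>i\<in>UNIV. (cmod (dilate r v $ i))\<^sup>2) \<le> (\<Sum>i\<in>UNIV. (cmod (v $ i))\<^sup>2)"
    using assms
    by (intro sum_mono power_mono) (auto simp: dilate_def norm_mult mult_left_le_one_le)
  moreover have "dilate r v \<noteq> 0" using assms dilate_eq_0_iff[of r v] by simp
  ultimately show ?thesis using assms norm_ratio_hclass[of v r] sum_norm_pos[of "dilate r v"]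
    by simp
qed

text \<open>Adding its \<open>ddbar\<close> to \<open>omega\<close> gives the pullback of
  \<open>omega\<close>, which is positive. Phase rotations and the transposition commute with
  dilations and preserve all norms involved, and for r \<le> 1 no norm increases.\<close>

lemma dilation_potential_in_potentials:
  assumes r: "0 < r" "r \<le> 1"
  shows "dilation_potential r \<in> potentials sym_group"
proof -
  have r0: "r \<noteq> 0" using r by simp
  have el: "elementary (\<lambda>z. dilation_potential r (chart k z))" if k: "k < length lifts" for k
  proof -
    have "elementary (\<lambda>z. log_norms (dilate_coords r ((lifts ! k) z)) + (-1) * log_norms ((lifts ! k) z))"
      using elementary_log_norms_dilate[OF k r0] elementary_log_norms_dilate[OF k, of 1]
      by (intro elementary_add elementary_mult elementary_const) (simp_all add: dilate_1)
    then show ?thesis by (simp add: dilation_potential_chart[OF k r0])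
  qed
  have "pos_form (omega k z + ddbar (\<lambda>w. dilation_potential r (chart k w)) z)"
    if k: "k < length lifts" for k z
  proof -
    have "omega k z + ddbar (\<lambda>w. dilation_potential r (chart k w)) z
      = ddbar (\<lambda>w. log_norms ((lifts ! k) w) + dilation_potential r (chart k w)) z"
      unfolding omega_def using elementary_log_norms_dilate[OF k, of 1] el[OF k]
      by (subst ddbar_add) (simp_all add: twice_differentiable_elementary dilate_1)
    also have "\<dots> = ddbar (\<lambda>w. log_norms (dilate_coords r ((lifts ! k) w))) z"
      by (simp add: dilation_potential_chart[OF k r0])
    finally show ?thesis using pos_form_ddbar_log_norms_dilate[OF k r0] by simp
  qed
  moreover have "(SUP p\<in>surface. dilation_potential r p) = 0"
  proof (rule cSup_eq_maximum)
    \<comment> \<open>At the origin, the point [1,0,0], only the coordinates left fixed by the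
      dilation survive, so the maximum 0 is attained.\<close>
    have "dilation_potential r (chart 0 0) = 0"
      by (subst dilation_potential_chart)
        (simp_all only: length_lifts log_norms_dilate_lift_0 log_norms_lift_0 r0, simp_all add: weight_def)
    then show "0 \<in> dilation_potential r ` surface"
      by (metis chart_in_surface imageI length_lifts zero_less_numeral)
  next
    fix x assume "x \<in> dilation_potential r ` surface"
    then obtain Z X Y where "x = dilation_potential r (to_point (Z, X, Y))" "Z \<noteq> 0" "X \<noteq> 0" "Y \<noteq> 0"
      unfolding surface_def by blast
    then show "x \<le> 0"
      using norm_ratio_le_0[of Z r] norm_ratio_le_0[of X r] norm_ratio_le_0[of Y r] r
      by (simp add: dilation_potential_def to_point_def)
  qed
  moreover have "\<forall>g\<in>sym_group. \<forall>p\<in>surface. dilation_potential r (g p) = dilation_potential r p"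
    using sym_group_invariant[where \<phi> = "dilation_potential r"] dilation_potential_sym_gens[OF r0]
    by blast
  moreover have "smooth_on_surface (dilation_potential r)"
    unfolding smooth_on_surface_def using el smooth_elementary by blast
  ultimately show ?thesis by (simp add: potentials_def)
qed


section \<open>Divergence above the threshold\<close>

lemma Basis_complex2: "(Basis :: (complex^2) set) = {axis 0 1, axis 0 \<i>, axis 1 1, axis 1 \<i>}"
  by (auto simp: Basis_vec_def Basis_complex_def UNIV_2_eq)

lemma inner_axis_complex:
  "z \<bullet> axis j 1 = Re (z $ j)" "z \<bullet> axis j \<i> = Im (z $ j)" for z :: "complex^'n::finite"
  by (simp_all add: inner_axis inner_complex_def)

lemma prod_Basis_complex2:
  "(\<Prod>b\<in>(Basis :: (complex^2) set). f b) = f (axis 0 1) * f (axis 0 \<i>) * f (axis 1 1) * f (axis 1 \<i>)"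
  for f :: "complex^2 \<Rightarrow> 'a::comm_monoid_mult"
  unfolding Basis_complex2 by (simp add: axis_eq_axis mult_ac)

lemma integral_omega_sq_ge_chart_0:
  "(\<integral>\<^sup>+ z. f (chart 0 z) * ennreal (8 * Re (det (omega 0 z))) \<partial>lborel) \<le> integral_omega_sq f"
proof -
  let ?F = "\<lambda>k. \<integral>\<^sup>+ z. f (chart k z) * ennreal (8 * Re (det (omega k z)))
        * indicator {z. chart k z \<notin> (\<Union>j<k. range (chart j))} z \<partial>lborel"
  have "(\<integral>\<^sup>+ z. f (chart 0 z) * ennreal (8 * Re (det (omega 0 z))) \<partial>lborel) = ?F 0" by simp
  also have "\<dots> \<le> (\<Sum>k<length lifts. ?F k)"
    by (rule member_le_sum) (auto simp: length_lifts)
  finally show ?thesis unfolding integral_omega_sq_def .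
qed

text \<open>On a box of size R the weight is at least R^6 / 512, while at the point scaled by 1 / R
  it is at most 8; hence 4096. The density of omega^2 is at least R^(-6), and the box has volume R^4
  / 256.\<close>

lemma dilation_integral_ge:
  assumes \<alpha>: "\<alpha> > 0" and R: "R \<ge> 1"
  shows "ennreal (4096 powr (-\<alpha>) / 256 * R powr (6 * \<alpha> - 2))
    \<le> integral_omega_sq (\<lambda>p. ennreal (exp (- \<alpha> * dilation_potential (1 / R) p)))"
proof -
  \<comment> \<open>All four real coordinates range over [R/4, R/2], so that |a|^2 and |b|^2 lie
    between R^2 / 8 and R^2 / 2.\<close>
  define B where "B = cbox ((R / 4) *\<^sub>R One) ((R / 2) *\<^sub>R One :: complex^2)"
  have One: "(One :: complex^2) \<bullet> b = 1" if "b \<in> Basis" for b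
    using that by (simp add: inner_sum_left inner_Basis)
  have volume: "emeasure lborel B = ennreal ((R / 4) ^ 4)"
    unfolding B_def using R by (subst emeasure_lborel_cbox) (auto simp: One prod_Basis_complex2 inner_diff_left power_eq_if)
  have est: "4096 powr (-\<alpha>) * R powr (6 * \<alpha>) / R ^ 6
     \<le> exp (- \<alpha> * dilation_potential (1 / R) (chart 0 z)) * (8 * Re (det (omega 0 z)))"
    if "z \<in> B" for z
  proof -
    have sq: "(R / 4)\<^sup>2 \<le> (z \<bullet> b)\<^sup>2" "(z \<bullet> b)\<^sup>2 \<le> (R / 2)\<^sup>2" if "b \<in> Basis" for b
    proof -
      have "R / 4 \<le> z \<bullet> b" "z \<bullet> b \<le> R / 2"
        using \<open>z \<in> B\<close> that by (auto simp: B_def mem_box One)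
      then show "(R / 4)\<^sup>2 \<le> (z \<bullet> b)\<^sup>2" "(z \<bullet> b)\<^sup>2 \<le> (R / 2)\<^sup>2"
        using R by (auto intro!: power_mono)
    qed
    have nrm: "R\<^sup>2 / 8 \<le> (cmod (z $ j))\<^sup>2" "(cmod (z $ j))\<^sup>2 \<le> R\<^sup>2 / 2" if "j = 0 \<or> j = 1" for j
      using sq[of "axis j 1"] sq[of "axis j \<i>"] that
      by (auto simp: Basis_complex2 inner_axis_complex cmod_power2 power_divide)
    note n = nrm[of 0, simplified] nrm[of 1, simplified]
    have R2: "1 \<le> R\<^sup>2" using R by simp
    have lower: "R ^ 6 / 512 \<le> weight z"
    proof -
      have "(R\<^sup>2 / 8) * (R\<^sup>2 / 8) * (R\<^sup>2 / 8) \<le> weight z"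
        unfolding weight_def using n R2 by (intro mult_mono) auto
      then show ?thesis by (simp add: power_eq_if)
    qed
    have upper: "weight z \<le> 8 * R ^ 6"
    proof -
      have "weight z \<le> (2 * R\<^sup>2) * (2 * R\<^sup>2) * (2 * R\<^sup>2)"
        unfolding weight_def using n R2 by (intro mult_mono) auto
      then show ?thesis by (simp add: power_eq_if)
    qed
    have "(cmod ((1 / R) *\<^sub>R z $ j))\<^sup>2 \<le> 1 / 2" if "j = 0 \<or> j = 1" for j
      using nrm[OF that] R by (simp add: power_mult_distrib power_divide divide_simps)
    note s = this[of 0, simplified] this[of 1, simplified]
    have small: "weight ((1 / R) *\<^sub>R z) \<le> 8"
    proof -
      have "weight ((1 / R) *\<^sub>R z) \<le> 2 * 2 * 2"
        unfolding weight_def using s by (intro mult_mono) auto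
      then show ?thesis by simp
    qed
    have "R ^ 6 / 4096 \<le> weight z / weight ((1 / R) *\<^sub>R z)"
    proof -
      have "R ^ 6 / 4096 = (R ^ 6 / 512) / 8" by simp
      also have "\<dots> \<le> weight z / weight ((1 / R) *\<^sub>R z)"
        using lower small weight_pos[of "(1 / R) *\<^sub>R z"] weight_pos[of z] by (intro frac_le) auto
      finally show ?thesis .
    qed
    then have "(R ^ 6 / 4096) powr \<alpha> \<le> (weight z / weight ((1 / R) *\<^sub>R z)) powr \<alpha>"
      using \<alpha> R by (intro powr_mono2) auto
    also have "\<dots> = exp (- \<alpha> * dilation_potential (1 / R) (chart 0 z))"
    proof -
      have "dilation_potential (1 / R) (chart 0 z) = ln (weight ((1 / R) *\<^sub>R z)) - ln (weight z)"
        using R by (subst dilation_potential_chart)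
          (simp_all only: length_lifts log_norms_dilate_lift_0 log_norms_lift_0, simp_all)
      moreover have "(weight z / weight ((1 / R) *\<^sub>R z)) powr \<alpha>
          = exp (\<alpha> * (ln (weight z) - ln (weight ((1 / R) *\<^sub>R z))))"
        using weight_pos[of z] weight_pos[of "(1 / R) *\<^sub>R z"] by (simp add: powr_def ln_div)
      ultimately show ?thesis by (simp add: right_diff_distrib)
    qed
    finally have 1: "(R ^ 6 / 4096) powr \<alpha> \<le> exp (- \<alpha> * dilation_potential (1 / R) (chart 0 z))" .
    have 2: "1 / R ^ 6 \<le> 8 * Re (det (omega 0 z))"
    proof -
      have "1 / (8 * R ^ 6) \<le> 1 / weight z" using upper weight_pos[of z] R by (intro divide_left_mono) auto
      also have "\<dots> \<le> Re (det (omega 0 z))" by (rule det_omega_0_bounds)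
      finally show ?thesis by simp
    qed
    have "(R ^ 6 / 4096) powr \<alpha> = 4096 powr (-\<alpha>) * R powr (6 * \<alpha>)"
    proof -
      have "(R ^ 6) powr \<alpha> = R powr (6 * \<alpha>)"
        using powr_powr[of R 6 \<alpha>] R by simp
      then show ?thesis using R by (simp add: powr_divide powr_powr powr_minus divide_simps)
    qed
    moreover have "(R ^ 6 / 4096) powr \<alpha> * (1 / R ^ 6)
      \<le> exp (- \<alpha> * dilation_potential (1 / R) (chart 0 z)) * (8 * Re (det (omega 0 z)))"
      using 1 2 R by (intro mult_mono) auto
    ultimately show ?thesis by simp
  qed
  define c where "c = 4096 powr (-\<alpha>) * R powr (6 * \<alpha>) / R ^ 6"
  have "c * (R / 4) ^ 4 = 4096 powr (-\<alpha>) / 256 * R powr (6 * \<alpha> - 2)"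
  proof -
    have "R powr (6 * \<alpha> - 2) = R powr (6 * \<alpha>) / R\<^sup>2"
      using R by (simp add: powr_diff powr_numeral)
    then show ?thesis using R by (simp add: c_def power_divide power_eq_if)
  qed
  then have "ennreal (4096 powr (-\<alpha>) / 256 * R powr (6 * \<alpha> - 2)) = ennreal c * emeasure lborel B"
    using R by (simp add: volume ennreal_mult' c_def flip: ennreal_mult)
  also have "\<dots> = (\<integral>\<^sup>+ z. ennreal c * indicator B z \<partial>lborel)"
    by (rule nn_integral_cmult_indicator[symmetric]) (simp add: B_def)
  also have "\<dots> \<le> (\<integral>\<^sup>+ z. ennreal (exp (- \<alpha> * dilation_potential (1 / R) (chart 0 z)))
      * ennreal (8 * Re (det (omega 0 z))) \<partial>lborel)"
    using est by (intro nn_integral_mono)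
      (auto simp: c_def indicator_def simp flip: ennreal_mult' intro!: ennreal_leI)
  also have "\<dots> \<le> integral_omega_sq (\<lambda>p. ennreal (exp (- \<alpha> * dilation_potential (1 / R) p)))"
    by (rule integral_omega_sq_ge_chart_0)
  finally show ?thesis .
qed

lemma exponent_le_third:
  assumes \<alpha>: "\<alpha> > 0"
    and bound: "\<And>\<phi>. \<phi> \<in> potentials sym_group \<Longrightarrow>
      integral_omega_sq (\<lambda>p. ennreal (exp (- \<alpha> * \<phi> p))) \<le> ennreal C"
  shows "\<alpha> \<le> 1 / 3"
proof (rule ccontr)
  assume "\<not> \<alpha> \<le> 1 / 3"
  then have e: "6 * \<alpha> - 2 > 0" by simp
  define c :: real where "c = 4096 powr (-\<alpha>) / 256"
  have c: "c > 0" by (simp add: c_def)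
  \<comment> \<open>\<open>K\<close> is the value wanted for R powr (6 alpha - 2). The maximum with
    1 ensures R \<ge> 1, and |C| + 1 beats \<open>C\<close> whatever its sign.\<close>
  define K where "K = max 1 ((\<bar>C\<bar> + 1) / c)"
  define R where "R = K powr (1 / (6 * \<alpha> - 2))"
  have R: "R \<ge> 1" unfolding R_def using e by (intro ge_one_powr_ge_zero) (auto simp: K_def)
  have "R powr (6 * \<alpha> - 2) = K" using e by (simp add: R_def powr_powr K_def)
  then have "ennreal (c * K) \<le> ennreal C"
    using order.trans[OF dilation_integral_ge[OF \<alpha> R] bound[OF dilation_potential_in_potentials]] R
    by (simp add: c_def)
  moreover have "c * K \<ge> \<bar>C\<bar> + 1"
    using c by (auto simp: K_def field_simps max_def)
  ultimately show False using c by (simp add: ennreal_le_iff2) linarith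
qed


section \<open>The integral in the torus chart\<close>

lemma AE_inner_Basis_nonzero:
  "AE z in lborel. \<forall>b\<in>Basis. (z :: 'a::euclidean_space) \<bullet> b \<noteq> 0"
proof (subst AE_ball_countable)
  show "countable (Basis :: 'a set)" by (simp add: countable_finite)
  show "\<forall>b\<in>Basis. AE z in lborel. (z :: 'a) \<bullet> b \<noteq> 0"
  proof
    fix b :: 'a assume b: "b \<in> Basis"
    then have "negligible {z. b \<bullet> z = 0}" by (intro negligible_hyperplane) auto
    then have "{z. b \<bullet> z = 0} \<in> null_sets lebesgue" by (simp add: negligible_iff_null_sets)
    moreover have "{z. b \<bullet> z = 0} \<in> sets lborel"
      using closed_hyperplane[of b 0] by (simp add: borel_closed)
    ultimately have "{z. b \<bullet> z = 0} \<in> null_sets lborel"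
      by (simp add: null_sets_completion_iff)
    then show "AE z in lborel. z \<bullet> b \<noteq> 0"
      by (auto dest!: AE_not_in simp: inner_commute)
  qed
qed

lemma AE_coordinates_nonzero: "AE z in lborel. (z :: complex^2) $ 0 \<noteq> 0 \<and> z $ 1 \<noteq> 0"
  using AE_inner_Basis_nonzero
  by (rule AE_mp) (auto simp: Basis_complex2 inner_axis_complex)

text \<open>The witnesses are the torus coordinates Z_1 / Z_0 and Z_2 / Z_0 of the point; in every
  chart Z_0 is nonzero off the axes.\<close>

lemma chart_eq_chart_0:
  assumes "k < length lifts" "z $ 0 \<noteq> 0" "z $ 1 \<noteq> 0"
  obtains w where "w $ 0 \<noteq> 0" "w $ 1 \<noteq> 0" "chart k z = chart 0 w"
proof -
  have "\<exists>w. w $ 0 \<noteq> 0 \<and> w $ 1 \<noteq> 0 \<and> chart k z = chart 0 w"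
    using assms(1) unfolding length_lifts less_5
  proof (elim disjE)
    assume "k = 0"
    then show ?thesis using assms by blast
  next
    assume k: "k = 1"
    show ?thesis using assms unfolding k
      by (intro exI[of _ "vec2 (1 / z $ 0) (z $ 1)"])
        (auto simp: chart_def lift_simps lift_simps[simplified] to_point_eq_iff vec3_eq_iff vec2_eq_iff
          intro!: exI[of _ "z $ 0"] exI[of _ 1])
  next
    assume k: "k = 2"
    show ?thesis using assms unfolding k
      by (intro exI[of _ "vec2 (1 / (z $ 0 * z $ 1)) (1 / z $ 0)"])
        (auto simp: chart_def lift_simps lift_simps[simplified] to_point_eq_iff vec3_eq_iff vec2_eq_iff
          intro!: exI[of _ "z $ 0"] exI[of _ "z $ 0 * z $ 1"])
  next
    assume k: "k = 3"
    show ?thesis using assms unfolding k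
      by (intro exI[of _ "vec2 (z $ 1) (1 / z $ 0)"])
        (auto simp: chart_def lift_simps lift_simps[simplified] to_point_eq_iff vec3_eq_iff vec2_eq_iff
          intro!: exI[of _ "z $ 0"] exI[of _ 1])
  next
    assume k: "k = 4"
    show ?thesis using assms unfolding k
      by (intro exI[of _ "vec2 (1 / z $ 0) (1 / (z $ 0 * z $ 1))"])
        (auto simp: chart_def lift_simps lift_simps[simplified] to_point_eq_iff vec3_eq_iff vec2_eq_iff
          intro!: exI[of _ "z $ 0"] exI[of _ "z $ 0 * z $ 1"])
  qed
  then show thesis using that by blast
qed

text \<open>The part of any other chart that chart 0 misses lies in the coordinate axes, a null
  set.\<close>

lemma integral_omega_sq_eq:
  "integral_omega_sq f = (\<integral>\<^sup>+ z. f (chart 0 z) * ennreal (8 * Re (det (omega 0 z))) \<partial>lborel)"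
proof -
  let ?F = "\<lambda>k. \<integral>\<^sup>+ z. f (chart k z) * ennreal (8 * Re (det (omega k z)))
        * indicator {z. chart k z \<notin> (\<Union>j<k. range (chart j))} z \<partial>lborel"
  have "?F k = 0" if k: "k < length lifts" "k \<noteq> 0" for k
  proof -
    have "?F k = (\<integral>\<^sup>+ z. 0 \<partial>(lborel :: (complex^2) measure))"
    proof (rule nn_integral_cong_AE, rule AE_mp[OF AE_coordinates_nonzero], rule AE_I2, rule impI)
      fix z :: "complex^2" assume "z $ 0 \<noteq> 0 \<and> z $ 1 \<noteq> 0"
      then have "chart k z \<in> range (chart 0)"
        using chart_eq_chart_0[OF k(1)] by blast
      then have "chart k z \<in> (\<Union>j<k. range (chart j))" using k(2) by blast
      then show "f (chart k z) * ennreal (8 * Re (det (omega k z)))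
        * indicator {z. chart k z \<notin> (\<Union>j<k. range (chart j))} z = 0"
        by (simp only: indicator_simps mem_Collect_eq not_True_eq_False mult_zero_right simp_thms)
    qed
    then show ?thesis by simp
  qed
  then have "(\<Sum>k<length lifts. ?F k) = (\<Sum>k\<in>{0}. ?F k)"
    by (intro sum.mono_neutral_right) (auto simp: length_lifts)
  then show ?thesis unfolding integral_omega_sq_def by simp
qed


section \<open>An integrable majorant\<close>

text \<open>One factor for each of the four real coordinates: decay of order g at infinity and a
  singularity of order d at 0, so the integral over the plane splits into one-dimensional
  ones.\<close>

definition majorant :: "real \<Rightarrow> real \<Rightarrow> real \<Rightarrow> real" where
  "majorant g d x = (1 + x\<^sup>2) powr (- g / 2) * (1 + \<bar>x\<bar> powr (- d))"

lemma borel_measurable_majorant [measurable]: "majorant g d \<in> borel_measurable borel"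
  unfolding majorant_def by measurable

lemma majorant_nonneg: "majorant g d x \<ge> 0"
  by (simp add: majorant_def)

lemma nn_integral_majorant_finite:
  assumes g: "g > 1" and d: "0 < d" "d < 1"
  shows "(\<integral>\<^sup>+ x. ennreal (majorant g d x) \<partial>lborel) < \<infinity>"
proof -
  \<comment> \<open>\<open>H\<close> lives on the half line, where power integrals are available,
    and is reflected afterwards. The factor 2 bounds 1 + x powr (- d) for x \<ge> 1.\<close>
  define H where "H = (\<lambda>x::real. (if x \<in> {0..1} then 1 + x powr (- d) else 0)
      + (if x \<in> {1..} then 2 * x powr (- g) else 0))"
  have H_nonneg: "H x \<ge> 0" for x by (simp add: H_def)
  have [measurable]: "H \<in> borel_measurable borel" unfolding H_def by measurable
  have "((\<lambda>x. x powr (- d)) has_integral (1 powr (- d + 1) / (- d + 1))) {0..1}"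
    using d by (intro has_integral_powr_from_0) auto
  from has_integral_add[OF has_integral_const_real[of 1 0 1] this]
  have I1: "((\<lambda>x. 1 + x powr (- d)) has_integral (1 + 1 / (1 - d))) {0..1}" by simp
  have "((\<lambda>x. x powr (- g)) has_integral -(1 powr (- g + 1)) / (- g + 1)) {1..}"
    using g by (intro has_integral_powr_to_inf) auto
  from has_integral_mult_right[OF this, of 2]
  obtain J where I2: "((\<lambda>x. 2 * x powr (- g)) has_integral J) {1..}" by blast
  have "(H has_integral (1 + 1 / (1 - d) + J)) UNIV"
    unfolding H_def
    by (intro has_integral_add) (use I1 I2 in \<open>simp_all only: has_integral_restrict_UNIV\<close>)
  from nn_integral_has_integral_lborel[OF _ H_nonneg this]
  have fin: "(\<integral>\<^sup>+ x. ennreal (H x) \<partial>lborel) < \<infinity>" by simp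
  have le: "majorant g d x \<le> H x + H (- x)" for x
  proof -
    have pos: "majorant g d y \<le> H y" if y: "y \<ge> 0" for y
    proof (cases "y \<le> 1")
      case True
      have "(1 + y\<^sup>2) powr (- g / 2) \<le> 1 powr (- g / 2)"
        using g by (intro powr_mono2') auto
      then have "majorant g d y \<le> 1 * (1 + y powr (- d))"
        using y unfolding majorant_def by (intro mult_mono) auto
      also have "\<dots> \<le> H y" using True y by (simp add: H_def)
      finally show ?thesis .
    next
      case False
      have "(1 + y\<^sup>2) powr (- g / 2) \<le> (y\<^sup>2) powr (- g / 2)"
        using g False by (intro powr_mono2') auto
      also have "\<dots> = y powr (- g)"
        using False by (simp add: powr_powr flip: powr_numeral)
      finally have "(1 + y\<^sup>2) powr (- g / 2) \<le> y powr (- g)" .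
      moreover have "y powr (- d) \<le> 1 powr (- d)"
        using d False by (intro powr_mono2') auto
      ultimately have "majorant g d y \<le> y powr (- g) * 2"
        using y unfolding majorant_def by (intro mult_mono) auto
      then show ?thesis using False by (simp add: H_def)
    qed
    have even: "majorant g d (- x) = majorant g d x" by (simp add: majorant_def)
    show ?thesis
      using pos[of x] pos[of "- x"] even H_nonneg[of x] H_nonneg[of "- x"] by (cases "x \<ge> 0") auto
  qed
  have "(\<integral>\<^sup>+ x. ennreal (majorant g d x) \<partial>lborel) \<le> (\<integral>\<^sup>+ x. ennreal (H x) + ennreal (H (- x)) \<partial>lborel)"
    using le H_nonneg by (intro nn_integral_mono) (simp flip: ennreal_plus add: ennreal_leI)
  also have "\<dots> = (\<integral>\<^sup>+ x. ennreal (H x) \<partial>lborel) + (\<integral>\<^sup>+ x. ennreal (H (- x)) \<partial>lborel)"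
    by (rule nn_integral_add) simp_all
  also have "(\<integral>\<^sup>+ x. ennreal (H (- x)) \<partial>lborel) = (\<integral>\<^sup>+ x. ennreal (H x) \<partial>lborel)"
    using nn_integral_real_affine[of "\<lambda>x. ennreal (H x)" "-1" 0] by simp
  finally show ?thesis using fin by (simp add: ennreal_add_less_top order.strict_trans1)
qed

text \<open>Separation of variables by (f 0 f 1)^3 \<le> weight^4, which gives the decay exponent 3
  \<beta> / 2 for each real coordinate. Both sides are of order R^24 when all four coordinates are
  of order R, so no power is lost in the direction that decides the threshold. The singular factor
  splits by |Re z| |Im z| \<le> |z|^2.\<close>

lemma weight_powr_le:
  fixes z :: "complex^2"
  assumes b: "0 < \<beta>" and nz: "\<forall>b\<in>Basis. z \<bullet> b \<noteq> 0" and "0 < d"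
  shows "weight z powr (- \<beta>) * (1 + (cmod (z $ 0) * cmod (z $ 1)) powr (- 2 * d))
    \<le> (\<Prod>b\<in>Basis. majorant (3 * \<beta> / 2) d (z \<bullet> b))"
proof -
  define f where "f = (\<lambda>j. (1 + (Re (z $ j))\<^sup>2) * (1 + (Im (z $ j))\<^sup>2))"
  define t where "t = (\<lambda>x::real. \<bar>x\<bar> powr (- d))"
  define P where "P = (\<lambda>j. 1 + (cmod (z $ j))\<^sup>2)"
  have P1: "P j \<ge> 1" for j by (simp add: P_def)
  have f1: "f j \<ge> 1" for j
    unfolding f_def using mult_mono[of 1 "1 + (Re (z $ j))\<^sup>2" 1 "1 + (Im (z $ j))\<^sup>2"] by simp
  have fP: "f j \<le> (P j)\<^sup>2" for j
  proof -
    have "(P j)\<^sup>2 = f j + ((Re (z $ j))\<^sup>2 + (Im (z $ j))\<^sup>2 + ((Re (z $ j))\<^sup>2)\<^sup>2 + ((Im (z $ j))\<^sup>2)\<^sup>2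
        + (Re (z $ j))\<^sup>2 * (Im (z $ j))\<^sup>2)"
      unfolding P_def f_def cmod_power2 by (simp add: algebra_simps power2_eq_square)
    then show ?thesis by (simp add: add_increasing2)
  qed
  \<comment> \<open>As P 0 and P 1 are at least 1, both are at most P 0 + P 1 - 1, whose square is
    therefore at least P 0 * P 1.\<close>
  have W: "(P 0 * P 1) ^ 3 \<le> (weight z)\<^sup>2"
  proof -
    have "P 0 * P 1 \<le> (P 0 + P 1 - 1) * (P 0 + P 1 - 1)"
      using P1[of 0] P1[of 1] by (intro mult_mono) auto
    then have "(P 0 * P 1) * (P 0 * P 1)\<^sup>2 \<le> ((P 0 + P 1 - 1) * (P 0 + P 1 - 1)) * (P 0 * P 1)\<^sup>2"
      by (intro mult_right_mono) auto
    moreover have "weight z = (P 0 + P 1 - 1) * (P 0 * P 1)"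
      by (simp add: weight_def P_def)
    ultimately show ?thesis by (simp add: power2_eq_square power3_eq_cube mult_ac)
  qed
  have "(f 0 * f 1) ^ 3 \<le> (weight z ^ 2)\<^sup>2"
  proof -
    have "(f 0 * f 1) ^ 3 \<le> ((P 0)\<^sup>2 * (P 1)\<^sup>2) ^ 3"
      using fP[of 0] fP[of 1] f1[of 0] f1[of 1] by (intro power_mono mult_mono) auto
    also have "\<dots> = ((P 0 * P 1) ^ 3)\<^sup>2" by (simp add: power_mult_distrib flip: power_mult)
    also have "\<dots> \<le> (weight z ^ 2)\<^sup>2"
      using W P1[of 0] P1[of 1] by (intro power_mono) auto
    finally show ?thesis .
  qed
  then have "(f 0 * f 1) ^ 3 \<le> weight z ^ 4" by (simp flip: power_mult)
  moreover have ff: "f 0 * f 1 > 0" using f1[of 0] f1[of 1] by (intro mult_pos_pos) auto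
  ultimately have "(weight z ^ 4) powr (- \<beta> / 4) \<le> ((f 0 * f 1) ^ 3) powr (- \<beta> / 4)"
    using b by (intro powr_mono2') auto
  moreover have "(weight z ^ 4) powr (- \<beta> / 4) = weight z powr (- \<beta>)"
    using weight_pos[of z] by (simp add: powr_powr flip: powr_numeral)
  moreover have "((f 0 * f 1) ^ 3) powr (- \<beta> / 4) = (f 0 * f 1) powr (- (3 * \<beta> / 2) / 2)"
  proof -
    show ?thesis using powr_powr[of "f 0 * f 1" 3 "- \<beta> / 4"] ff by simp
  qed
  ultimately have first: "weight z powr (- \<beta>) \<le> (f 0 * f 1) powr (- (3 * \<beta> / 2) / 2)" by simp
  have nz': "Re (z $ j) \<noteq> 0" "Im (z $ j) \<noteq> 0" if "j = 0 \<or> j = 1" for j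
    using nz that by (auto simp: Basis_complex2 inner_axis_complex)
  have coord: "(cmod (z $ j)) powr (- 2 * d) \<le> t (Re (z $ j)) * t (Im (z $ j))" if j: "j = 0 \<or> j = 1" for j
  proof -
    have pos: "\<bar>Re (z $ j)\<bar> * \<bar>Im (z $ j)\<bar> > 0" using nz'[OF j] by simp
    have cp: "cmod (z $ j) > 0" using nz'[OF j] by auto
    have "\<bar>Re (z $ j)\<bar> * \<bar>Im (z $ j)\<bar> \<le> cmod (z $ j) * cmod (z $ j)"
      by (intro mult_mono abs_Re_le_cmod abs_Im_le_cmod) auto
    then have "(cmod (z $ j) * cmod (z $ j)) powr (- d) \<le> (\<bar>Re (z $ j)\<bar> * \<bar>Im (z $ j)\<bar>) powr (- d)"
      using assms pos by (intro powr_mono2') auto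
    moreover have "(cmod (z $ j) * cmod (z $ j)) powr (- d) = cmod (z $ j) powr (- 2 * d)"
      using cp by (simp add: powr_mult flip: powr_add)
    ultimately show ?thesis by (simp add: t_def powr_mult)
  qed
  have t0: "t x \<ge> 0" for x by (simp add: t_def)
  have "(cmod (z $ 0) * cmod (z $ 1)) powr (- 2 * d)
      \<le> (t (Re (z $ 0)) * t (Im (z $ 0))) * (t (Re (z $ 1)) * t (Im (z $ 1)))"
    unfolding powr_mult using coord t0 by (intro mult_mono) auto
  moreover have four: "1 + (p * q) * (r * s) \<le> (1 + p) * (1 + q) * ((1 + r) * (1 + s))"
    if "p \<ge> 0" "q \<ge> 0" "r \<ge> 0" "s \<ge> 0" for p q r s :: real
  proof -
    have two: "1 + p * q \<le> (1 + p) * (1 + q)" if "p \<ge> 0" "q \<ge> 0" for p q :: real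
      using that by (simp add: algebra_simps)
    have "1 + (p * q) * (r * s) \<le> (1 + p * q) * (1 + r * s)" using that by (intro two) auto
    also have "\<dots> \<le> ((1 + p) * (1 + q)) * ((1 + r) * (1 + s))"
      using that by (intro mult_mono two) auto
    finally show ?thesis .
  qed
  ultimately have second: "1 + (cmod (z $ 0) * cmod (z $ 1)) powr (- 2 * d) \<le>
     (1 + t (Re (z $ 0))) * (1 + t (Im (z $ 0))) * ((1 + t (Re (z $ 1))) * (1 + t (Im (z $ 1))))"
    using four[OF t0 t0 t0 t0] by (meson add_left_mono order_trans)
  have "weight z powr (- \<beta>) * (1 + (cmod (z $ 0) * cmod (z $ 1)) powr (- 2 * d))
    \<le> (f 0 * f 1) powr (- (3 * \<beta> / 2) / 2) *
      ((1 + t (Re (z $ 0))) * (1 + t (Im (z $ 0))) * ((1 + t (Re (z $ 1))) * (1 + t (Im (z $ 1)))))"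
    using first second by (intro mult_mono) auto
  also have "\<dots> = (\<Prod>b\<in>Basis. majorant (3 * \<beta> / 2) d (z \<bullet> b))"
    unfolding prod_Basis_complex2 inner_axis_complex majorant_def t_def f_def
    by (simp add: powr_mult mult_ac)
  finally show ?thesis .
qed

lemma integral_omega_sq_bounded:
  assumes \<alpha>: "0 < \<alpha>" "\<alpha> < 1 / 3"
  shows "\<exists>C>0. \<forall>\<phi>. (\<forall>z. z $ 0 \<noteq> 0 \<longrightarrow> z $ 1 \<noteq> 0 \<longrightarrow>
        min 0 (3 * ln (cmod (z $ 0) * cmod (z $ 1))) \<le> \<phi> (chart 0 z) + ln (weight z)) \<longrightarrow>
      integral_omega_sq (\<lambda>p. ennreal (exp (- \<alpha> * \<phi> p))) \<le> ennreal C"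
proof -
  \<comment> \<open>The decay exponent is 3 \<beta> / 2 for \<beta> = 1 - \<alpha>, and g > 1 is
    exactly \<alpha> < 1/3. The singularity |a b| powr (- 3 \<alpha>) is written with 2 d = 3
    \<alpha>.\<close>
  define g d where "g = 3 * (1 - \<alpha>) / 2" and "d = 3 * \<alpha> / 2"
  have gd: "g > 1" "0 < d" "d < 1" using \<alpha> by (auto simp: g_def d_def)
  define M where "M = (\<integral>\<^sup>+ x. ennreal (majorant g d x) \<partial>lborel)"
  have "32 * M ^ 4 < \<infinity>"
    using nn_integral_majorant_finite[OF gd] unfolding M_def
    by (simp add: ennreal_mult_less_top power_less_top_ennreal)
  then obtain C where C: "C \<ge> 0" "32 * M ^ 4 = ennreal C"
    by (cases "32 * M ^ 4") auto
  have "integral_omega_sq (\<lambda>p. ennreal (exp (- \<alpha> * \<phi> p))) \<le> ennreal C"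
    if bound: "\<And>z. z $ 0 \<noteq> 0 \<Longrightarrow> z $ 1 \<noteq> 0 \<Longrightarrow>
        min 0 (3 * ln (cmod (z $ 0) * cmod (z $ 1))) \<le> \<phi> (chart 0 z) + ln (weight z)" for \<phi>
  proof -
    have pw: "exp (- \<alpha> * \<phi> (chart 0 z)) * (8 * Re (det (omega 0 z)))
        \<le> 32 * (\<Prod>b\<in>Basis. majorant g d (z \<bullet> b))" if nz: "\<forall>b\<in>Basis. z \<bullet> b \<noteq> 0" for z
    proof -
      define s where "s = cmod (z $ 0) * cmod (z $ 1)"
      have z: "z $ 0 \<noteq> 0" "z $ 1 \<noteq> 0"
        using nz by (auto simp: Basis_complex2 inner_axis_complex)
      then have s: "s > 0" by (simp add: s_def)
      have "- \<phi> (chart 0 z) \<le> ln (weight z) + max 0 (- 3 * ln s)"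
        using bound[OF z] unfolding s_def by linarith
      then have "\<alpha> * (- \<phi> (chart 0 z)) \<le> \<alpha> * (ln (weight z) + max 0 (- 3 * ln s))"
        using \<alpha> by (intro mult_left_mono) auto
      then have "exp (- \<alpha> * \<phi> (chart 0 z)) \<le> exp (\<alpha> * ln (weight z) + \<alpha> * max 0 (- 3 * ln s))"
        by (simp add: algebra_simps)
      also have "\<dots> = weight z powr \<alpha> * exp (\<alpha> * max 0 (- 3 * ln s))"
        using weight_pos[of z] by (simp add: exp_add powr_def)
      finally have e: "exp (- \<alpha> * \<phi> (chart 0 z)) \<le> weight z powr \<alpha> * exp (\<alpha> * max 0 (- 3 * ln s))" .
      have "exp (\<alpha> * max 0 (- 3 * ln s)) \<le> 1 + s powr (- 2 * d)"
        using s by (simp add: powr_def d_def max_def mult_ac)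
      then have e: "exp (- \<alpha> * \<phi> (chart 0 z)) \<le> weight z powr \<alpha> * (1 + s powr (- 2 * d))"
        by (intro order.trans[OF e] mult_left_mono) auto
      \<comment> \<open>The final factor 32 is the 8 of the volume form times the 4 of the
        determinant bound.\<close>
      have "exp (- \<alpha> * \<phi> (chart 0 z)) * (8 * Re (det (omega 0 z)))
        \<le> weight z powr \<alpha> * (1 + s powr (- 2 * d)) * (8 * (4 / weight z))"
      proof (intro mult_mono e)
        show "0 \<le> 8 * Re (det (omega 0 z))"
          using det_omega_0_bounds(1)[of z] weight_pos[of z] by (smt (verit) zero_le_divide_1_iff)
      qed (use det_omega_0_bounds[of z] in auto)
      also have "\<dots> = 32 * (weight z powr (- (1 - \<alpha>)) * (1 + s powr (- 2 * d)))"
        using weight_pos[of z] by (simp add: powr_diff)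
      also have "\<dots> \<le> 32 * (\<Prod>b\<in>Basis. majorant g d (z \<bullet> b))"
        unfolding s_def g_def using \<alpha> gd by (intro mult_left_mono weight_powr_le nz) auto
      finally show ?thesis .
    qed
    have "integral_omega_sq (\<lambda>p. ennreal (exp (- \<alpha> * \<phi> p)))
      \<le> (\<integral>\<^sup>+ z. 32 * (\<Prod>b\<in>Basis. ennreal (majorant g d ((z :: complex^2) \<bullet> b))) \<partial>lborel)"
      unfolding integral_omega_sq_eq
    proof (rule nn_integral_mono_AE, rule AE_mp[OF AE_inner_Basis_nonzero], rule AE_I2, rule impI)
      fix z :: "complex^2" assume "\<forall>b\<in>Basis. z \<bullet> b \<noteq> 0"
      from pw[OF this] show "ennreal (exp (- \<alpha> * \<phi> (chart 0 z))) * ennreal (8 * Re (det (omega 0 z)))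
          \<le> 32 * (\<Prod>b\<in>Basis. ennreal (majorant g d (z \<bullet> b)))"
        by (simp add: prod_ennreal majorant_nonneg prod_nonneg ennreal_leI ennreal_mult'
            flip: ennreal_mult' ennreal_numeral)
    qed
    also have "\<dots> = 32 * (\<integral>\<^sup>+ z. (\<Prod>b\<in>Basis. ennreal (majorant g d ((z :: complex^2) \<bullet> b))) \<partial>lborel)"
      by (rule nn_integral_cmult) measurable
    also have "\<dots> = 32 * M ^ 4"
      by (subst nn_integral_lborel_prod) (simp_all add: M_def prod_Basis_complex2 power_eq_if mult_ac)
    finally show ?thesis by (simp add: C)
  qed
  \<comment> \<open>The bound \<open>C\<close> is only known to be nonnegative, whereas a positive
    constant is required.\<close>
  then have "integral_omega_sq (\<lambda>p. ennreal (exp (- \<alpha> * \<phi> p))) \<le> ennreal (C + 1)"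
    if "\<forall>z. z $ 0 \<noteq> 0 \<longrightarrow> z $ 1 \<noteq> 0 \<longrightarrow>
        min 0 (3 * ln (cmod (z $ 0) * cmod (z $ 1))) \<le> \<phi> (chart 0 z) + ln (weight z)" for \<phi>
    using that C(1) by (meson ennreal_leI le_add_same_cancel1 order_trans zero_le_one)
  then show ?thesis using C(1) by (intro exI[of _ "C + 1"]) auto
qed


section \<open>Convexity in logarithmic coordinates\<close>

text \<open>The second derivative of \<open>U\<close> applied twice to \<open>v\<close>, with the
  basis derivative innermost; this is the order of differentiation in which the entries of
  \<open>ddbar\<close> arise.\<close>

definition hessian :: "('a::euclidean_space \<Rightarrow> real) \<Rightarrow> 'a \<Rightarrow> 'a \<Rightarrow> real" where
  "hessian U z v = (\<Sum>b\<in>Basis. (v \<bullet> b) * dir_deriv v (dir_deriv b U) z)"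

lemma dir_deriv_Basis:
  assumes "f differentiable (at z)"
  shows "dir_deriv v f z = (\<Sum>b\<in>Basis. (v \<bullet> b) * dir_deriv b f z)"
proof -
  interpret bounded_linear "\<lambda>v. dir_deriv v f z"
    using assms by (simp add: frechet_derivative_works has_derivative_bounded_linear)
  have "dir_deriv v f z = dir_deriv (\<Sum>b\<in>Basis. (v \<bullet> b) *\<^sub>R b) f z"
    by (simp only: euclidean_representation)
  then show ?thesis by (simp add: sum scaleR)
qed

lemma sum_Basis_complex2:
  "(\<Sum>b\<in>(Basis :: (complex^2) set). f b) = f (axis 0 1) + f (axis 0 \<i>) + f (axis 1 1) + f (axis 1 \<i>)"
  for f :: "complex^2 \<Rightarrow> 'a::comm_monoid_add"
  unfolding Basis_complex2 by (simp add: axis_eq_axis add_ac)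

text \<open>The Levi form as a Laplacian: the real Hessian is summed over the two real directions
  \<open>v\<close> and i \<open>v\<close> of a complex line.\<close>

lemma form_ddbar_eq_hessian:
  fixes U :: "complex^2 \<Rightarrow> real"
  assumes U: "twice_differentiable U"
  shows "4 * form (ddbar U z) v = hessian U z v + hessian U z (\<i> *s v)"
proof -
  have d: "dir_deriv w U differentiable (at z)" for w
    using U by (simp add: twice_differentiable_def)
  show ?thesis
    unfolding hessian_def form_def sum_UNIV_2 ddbar_entry[OF U] sum_Basis_complex2 inner_axis_complex
      dir_deriv_Basis[OF d, where v = v] dir_deriv_Basis[OF d, where v = "\<i> *s v"]
    by (simp add: algebra_simps add_divide_distrib diff_divide_distrib)
qed

lemma has_real_derivative_along_curve:
  assumes "\<And>x. f differentiable (at x)" "(\<gamma> has_vector_derivative v) (at t)"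
  shows "((\<lambda>t. f (\<gamma> t)) has_real_derivative dir_deriv v f (\<gamma> t)) (at t)"
proof -
  have f: "(f has_derivative (\<lambda>v. dir_deriv v f (\<gamma> t))) (at (\<gamma> t))"
    using assms(1) by (simp add: frechet_derivative_works)
  have "((\<lambda>t. f (\<gamma> t)) has_derivative (\<lambda>h. dir_deriv (h *\<^sub>R v) f (\<gamma> t))) (at t)"
    using has_derivative_compose[OF assms(2)[unfolded has_vector_derivative_def] f] .
  moreover have "dir_deriv (h *\<^sub>R v) f (\<gamma> t) = dir_deriv v f (\<gamma> t) * h" for h
    using linear_scale[OF has_derivative_linear[OF f]] by simp
  ultimately show ?thesis by (simp add: has_field_derivative_def)
qed

text \<open>Base point and direction move together. Expanding the direction in the basis separates
  them by the product rule, which adds an acceleration term to the Hessian.\<close>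

lemma has_real_derivative_along_curve2:
  assumes U: "twice_differentiable U"
    and g: "\<And>t. (\<gamma> has_vector_derivative \<gamma>' t) (at t)"
    and g': "\<And>t. (\<gamma>' has_vector_derivative \<gamma>'' t) (at t)"
  shows "((\<lambda>t. dir_deriv (\<gamma>' t) U (\<gamma> t)) has_real_derivative
     dir_deriv (\<gamma>'' t) U (\<gamma> t) + hessian U (\<gamma> t) (\<gamma>' t)) (at t)"
proof -
  have d1: "U differentiable (at x)" and d2: "dir_deriv b U differentiable (at x)" for b x
    using U by (auto simp: twice_differentiable_def)
  have 1: "((\<lambda>t. \<gamma>' t \<bullet> b) has_real_derivative \<gamma>'' t \<bullet> b) (at t)" for b
    using bounded_linear.has_vector_derivative[OF bounded_linear_inner_left g']
    by (simp add: has_real_derivative_iff_has_vector_derivative)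
  have "((\<lambda>t. \<Sum>b\<in>Basis. (\<gamma>' t \<bullet> b) * dir_deriv b U (\<gamma> t)) has_real_derivative
     (\<Sum>b\<in>Basis. (\<gamma>'' t \<bullet> b) * dir_deriv b U (\<gamma> t)
        + dir_deriv (\<gamma>' t) (dir_deriv b U) (\<gamma> t) * (\<gamma>' t \<bullet> b))) (at t)"
    by (intro DERIV_sum DERIV_mult 1 has_real_derivative_along_curve[OF d2 g])
  then show ?thesis
    unfolding hessian_def
    by (subst (1 2) dir_deriv_Basis[OF d1]) (simp add: sum.distrib mult_ac)
qed

lemma has_vector_derivative_vec2:
  assumes "(a has_vector_derivative a') (at x within S)" "(b has_vector_derivative b') (at x within S)"
  shows "((\<lambda>t. vec2 (a t) (b t)) has_vector_derivative vec2 a' b') (at x within S)"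
proof -
  have "bounded_linear (\<lambda>p. vec2 (fst p) (snd p))"
    unfolding linear_conv_bounded_linear[symmetric]
    by (rule linearI) (simp_all add: vec2_eq_iff)
  from bounded_linear.has_vector_derivative[OF this has_vector_derivative_Pair[OF assms]]
  show ?thesis by simp
qed

lemma has_vector_derivative_exp_curve:
  "((\<lambda>t. vec2 (a * exp (p * of_real t)) (b * exp (q * of_real t))) has_vector_derivative
     vec2 (a * p * exp (p * of_real t)) (b * q * exp (q * of_real t))) (at t)"
  by (intro has_vector_derivative_vec2 has_vector_derivative_real_field)
    (auto intro!: derivative_eq_intros)

definition log_coords :: "real \<Rightarrow> real \<Rightarrow> complex^2" where
  "log_coords s t = vec2 (of_real (exp s)) (of_real (exp t))"

text \<open>The line is the real trace of a holomorphic curve x + i y on which rotation invariance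
  makes \<open>U\<close> independent of y. The second derivative in x is then the whole Laplacian,
  hence nonnegative.\<close>

lemma convex_on_log_line:
  fixes U :: "complex^2 \<Rightarrow> real"
  assumes U: "twice_differentiable U"
    and pos: "\<And>z. pos_form (ddbar U z)"
    and rot: "\<And>c d a b. cmod c = 1 \<Longrightarrow> cmod d = 1 \<Longrightarrow> U (vec2 (c * a) (d * b)) = U (vec2 a b)"
  shows "convex_on UNIV (\<lambda>x. U (log_coords (s + m * x) (t + n * x)))"
proof -
  define A B M N where "A = complex_of_real (exp s)" and "B = complex_of_real (exp t)"
    and "M = complex_of_real m" and "N = complex_of_real n"
  define \<gamma> where "\<gamma> = (\<lambda>x::real. vec2 (A * exp (M * of_real x)) (B * exp (N * of_real x)))"
  define \<gamma>' where "\<gamma>' = (\<lambda>x::real. vec2 (A * M * exp (M * of_real x)) (B * N * exp (N * of_real x)))"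
  define \<gamma>'' where "\<gamma>'' = (\<lambda>x::real. vec2 (A * M * M * exp (M * of_real x)) (B * N * N * exp (N * of_real x)))"
  have g: "(\<gamma> has_vector_derivative \<gamma>' x) (at x)" "(\<gamma>' has_vector_derivative \<gamma>'' x) (at x)" for x
    unfolding \<gamma>_def \<gamma>'_def \<gamma>''_def by (rule has_vector_derivative_exp_curve)+
  have line: "log_coords (s + m * x) (t + n * x) = \<gamma> x" for x
    by (simp add: log_coords_def \<gamma>_def A_def B_def M_def N_def exp_add exp_of_real flip: of_real_mult)
  have d1: "U differentiable (at x)" for x using U by (simp add: twice_differentiable_def)
  show ?thesis
    unfolding line
  proof (rule f''_ge0_imp_convex)
    fix x
    show "((\<lambda>x. U (\<gamma> x)) has_real_derivative dir_deriv (\<gamma>' x) U (\<gamma> x)) (at x)"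
      by (rule has_real_derivative_along_curve[OF d1 g(1)])
    show "((\<lambda>x. dir_deriv (\<gamma>' x) U (\<gamma> x)) has_real_derivative
        dir_deriv (\<gamma>'' x) U (\<gamma> x) + hessian U (\<gamma> x) (\<gamma>' x)) (at x)"
      by (rule has_real_derivative_along_curve2[OF U g])
    (* U is constant along the rotation curve \<beta> through \<gamma> x, whose velocity is \<i> times that of \<gamma>
       and whose acceleration is opposite; adding its vanishing second derivative leaves the (1,1)-form. *)
    define a b where "a = A * exp (M * of_real x)" and "b = B * exp (N * of_real x)"
    define \<beta> where "\<beta> = (\<lambda>y::real. vec2 (a * exp (\<i> * M * of_real y)) (b * exp (\<i> * N * of_real y)))"
    define \<beta>' where "\<beta>' = (\<lambda>y::real. vec2 (a * (\<i> * M) * exp (\<i> * M * of_real y)) (b * (\<i> * N) * exp (\<i> * N * of_real y)))"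
    define \<beta>'' where "\<beta>'' = (\<lambda>y::real. vec2 (a * (\<i> * M) * (\<i> * M) * exp (\<i> * M * of_real y)) (b * (\<i> * N) * (\<i> * N) * exp (\<i> * N * of_real y)))"
    have h: "(\<beta> has_vector_derivative \<beta>' y) (at y)" "(\<beta>' has_vector_derivative \<beta>'' y) (at y)" for y
      unfolding \<beta>_def \<beta>'_def \<beta>''_def by (rule has_vector_derivative_exp_curve)+
    have "U (\<beta> y) = U (vec2 a b)" for y
    proof -
      have "U (\<beta> y) = U (vec2 (exp (\<i> * M * of_real y) * a) (exp (\<i> * N * of_real y) * b))"
        by (simp add: \<beta>_def mult.commute)
      also have "\<dots> = U (vec2 a b)"
        by (rule rot) (simp_all add: norm_exp_eq_Re M_def N_def)
      finally show ?thesis .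
    qed
    then have "((\<lambda>y. U (\<beta> y)) has_real_derivative 0) (at y)" for y by simp
    then have "dir_deriv (\<beta>' y) U (\<beta> y) = 0" for y
      using has_real_derivative_along_curve[OF d1 h(1)] DERIV_unique by blast
    then have "((\<lambda>y. dir_deriv (\<beta>' y) U (\<beta> y)) has_real_derivative 0) (at 0)" by simp
    then have *: "dir_deriv (\<beta>'' 0) U (\<beta> 0) + hessian U (\<beta> 0) (\<beta>' 0) = 0"
      using has_real_derivative_along_curve2[OF U h] DERIV_unique by blast
    have at0: "\<beta> 0 = \<gamma> x" "\<beta>' 0 = \<i> *s \<gamma>' x" "\<beta>'' 0 = - \<gamma>'' x"
      by (simp_all add: \<beta>_def \<beta>'_def \<beta>''_def \<gamma>_def \<gamma>'_def \<gamma>''_def a_def b_def vec2_eq_iff mult_ac)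
    have lin: "dir_deriv (- \<gamma>'' x) U (\<gamma> x) = - dir_deriv (\<gamma>'' x) U (\<gamma> x)"
      by (rule linear_neg) (use d1 linear_frechet_derivative in blast)
    have "dir_deriv (\<gamma>'' x) U (\<gamma> x) + hessian U (\<gamma> x) (\<gamma>' x) = 4 * form (ddbar U (\<gamma> x)) (\<gamma>' x)"
      using * unfolding form_ddbar_eq_hessian[OF U] at0 lin by simp
    \<comment> \<open>The velocity vanishes for m = n = 0, a vector about which
      \<open>pos_form\<close> says nothing.\<close>
    moreover have "form (ddbar U (\<gamma> x)) (\<gamma>' x) \<ge> 0"
      using pos[of "\<gamma> x"] by (cases "\<gamma>' x = 0") (auto simp: pos_form_def form_def less_imp_le)
    ultimately show "dir_deriv (\<gamma>'' x) U (\<gamma> x) + hessian U (\<gamma> x) (\<gamma>' x) \<ge> 0" by simp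
  qed simp
qed


section \<open>Convex functions of bounded growth\<close>

text \<open>The support function of twice the anticanonical polytope. The three maxima belong to a
  simplex and two segments, one for each projective factor; the 2 stems from |a|^2 = e^(2
  s).\<close>

definition support :: "real \<Rightarrow> real \<Rightarrow> real" where
  "support s t = 2 * (max 0 (max s t) + max 0 s + max 0 t)"

lemma support_scale: "r \<ge> 0 \<Longrightarrow> support (r * s) (r * t) = r * support s t"
  unfolding support_def
  by (simp add: max_mult_distrib_left algebra_simps)

lemma support_subadditive: "support (s + s') (t + t') \<le> support s t + support s' t'"
proof -
  have "max 0 (a + b) \<le> max 0 a + max 0 b" for a b :: real by auto
  moreover have "max 0 (max (s + s') (t + t')) \<le> max 0 (max s t) + max 0 (max s' t')" by auto
  ultimately show ?thesis unfolding support_def by (smt (verit))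
qed

lemma ln_one_plus_exp_bounds:
  fixes s :: real
  shows
  "2 * max 0 s \<le> ln (1 + (exp s)\<^sup>2)" "ln (1 + (exp s)\<^sup>2) \<le> 2 * max 0 s + ln 2"
proof -
  have e: "(exp s)\<^sup>2 = exp (2 * s)" by (simp add: exp_double)
  have "exp (2 * max 0 s) \<le> 1 + (exp s)\<^sup>2" unfolding e by (simp add: max_def)
  then show "2 * max 0 s \<le> ln (1 + (exp s)\<^sup>2)" by (subst ln_ge_iff) (auto intro: add_pos_nonneg)
  have "exp (2 * s) \<le> exp (2 * max 0 s)" "1 \<le> exp (2 * max 0 s)" by auto
  then have "1 + (exp s)\<^sup>2 \<le> exp (2 * max 0 s) * 2" unfolding e by linarith
  then have "ln (1 + (exp s)\<^sup>2) \<le> ln (exp (2 * max 0 s) * 2)"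
    by (intro ln_mono) (auto intro: add_pos_nonneg)
  then show "ln (1 + (exp s)\<^sup>2) \<le> 2 * max 0 s + ln 2" by (simp add: ln_mult)
qed

lemma ln_one_plus_exp_exp_bounds:
  fixes s t :: real
  shows
  "2 * max 0 (max s t) \<le> ln (1 + (exp s)\<^sup>2 + (exp t)\<^sup>2)"
  "ln (1 + (exp s)\<^sup>2 + (exp t)\<^sup>2) \<le> 2 * max 0 (max s t) + ln 3"
proof -
  have e: "(exp s)\<^sup>2 = exp (2 * s)" for s :: real by (simp add: exp_double)
  let ?m = "2 * max 0 (max s t)"
  have pos: "1 + exp (2 * s) + exp (2 * t) > 0" by (simp add: add_pos_pos)
  have "exp ?m \<le> 1 + exp (2 * s) + exp (2 * t)"
    using exp_gt_zero[of "2 * s"] exp_gt_zero[of "2 * t"] unfolding max_def by (simp add: add_increasing add_increasing2)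
  then show "?m \<le> ln (1 + (exp s)\<^sup>2 + (exp t)\<^sup>2)" unfolding e using pos by (subst ln_ge_iff) auto
  have "exp (2 * s) \<le> exp ?m" "exp (2 * t) \<le> exp ?m" "1 \<le> exp ?m" by auto
  then have "1 + exp (2 * s) + exp (2 * t) \<le> exp ?m * 3" by linarith
  then have "ln (1 + exp (2 * s) + exp (2 * t)) \<le> ln (exp ?m * 3)"
    using pos by (intro ln_mono) auto
  then show "ln (1 + (exp s)\<^sup>2 + (exp t)\<^sup>2) \<le> ?m + ln 3" unfolding e by (simp add: ln_mult)
qed

text \<open>The lower bound carries no constant, so that a point where phi is almost 0 has u almost
  above the support function. The constant in the upper bound only enters as a growth
  condition.\<close>

lemma ln_weight_bounds:
  "support s t \<le> ln (weight (log_coords s t))"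
  "ln (weight (log_coords s t)) \<le> support s t + (ln 3 + 2 * ln 2)"
proof -
  have pos: "1 + (exp s)\<^sup>2 + (exp t)\<^sup>2 > 0" "1 + (exp s)\<^sup>2 > 0" for s t :: real
    by (auto intro!: add_pos_nonneg)
  have "ln (weight (log_coords s t)) = ln (1 + (exp s)\<^sup>2 + (exp t)\<^sup>2) + ln (1 + (exp s)\<^sup>2) + ln (1 + (exp t)\<^sup>2)"
    using pos(1)[of s t] pos(2)[of s] pos(2)[of t] by (simp add: weight_def log_coords_def ln_mult)
  moreover note ln_one_plus_exp_bounds[of s] ln_one_plus_exp_bounds[of t]
    ln_one_plus_exp_exp_bounds[of s t]
  moreover have "support s t = 2 * max 0 (max s t) + 2 * max 0 s + 2 * max 0 t"
    by (simp only: support_def distrib_left)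
  ultimately show "support s t \<le> ln (weight (log_coords s t))"
    "ln (weight (log_coords s t)) \<le> support s t + (ln 3 + 2 * ln 2)"
    by simp_all
qed

text \<open>Increments of \<open>u\<close> are bounded by \<open>support\<close>; going from a
  diagonal point to one where \<open>u\<close> nearly reaches \<open>support\<close> bounds
  \<open>u\<close> below on the diagonal. Convexity and symmetry carry this bound to all
  points.\<close>

lemma symmetric_convex_lower_bound:
  fixes u :: "real \<Rightarrow> real \<Rightarrow> real"
  assumes conv: "\<And>s t m n. convex_on UNIV (\<lambda>x. u (s + m * x) (t + n * x))"
    and sym: "\<And>s t. u s t = u t s"
    and growth: "\<And>s t. u s t \<le> support s t + K"
    and near: "\<And>\<epsilon>. \<epsilon> > 0 \<Longrightarrow> \<exists>s t. support s t - \<epsilon> \<le> u s t"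
  shows "min 0 (3 * (s + t)) \<le> u s t"
proof -
  \<comment> \<open>By convexity, an increment larger than \<open>support a b\<close> by D > 0 would
    force an excess of at least r D after r steps, whereas the growth condition caps it at
    \<open>E\<close> for all r.\<close>
  have slope: "u (s + a) (t + b) - u s t \<le> support a b" for s t a b
  proof (rule ccontr)
    assume neg: "\<not> ?thesis"
    define F where "F = (\<lambda>x. u (s + a * x) (t + b * x))"
    define D where "D = F 1 - F 0 - support a b"
    have D: "D > 0" using neg by (simp add: D_def F_def)
    define E where "E = support s t + K - F 0"
    have bound: "r * D \<le> E" if r: "r \<ge> 1" for r
    proof -
      have "F 1 \<le> (1 - 1 / r) * F 0 + (1 / r) * F r"
        using convex_onD[OF conv[of s a t b], of "1 / r" 0 r] r by (simp add: F_def)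
      then have "r * F 1 \<le> r * ((1 - 1 / r) * F 0 + (1 / r) * F r)"
        using r by (intro mult_left_mono) auto
      also have "\<dots> = (r - 1) * F 0 + F r" using r by (simp add: field_simps)
      finally have "r * (F 1 - F 0) \<le> F r - F 0" by (simp add: algebra_simps)
      moreover have "F r \<le> support s t + r * support a b + K"
        using growth[of "s + a * r" "t + b * r"] support_subadditive[of s "a * r" t "b * r"]
          support_scale[of r a b] r by (simp add: F_def mult.commute)
      ultimately show ?thesis by (simp add: D_def E_def algebra_simps)
    qed
    have "max 1 (\<bar>E\<bar> / D + 1) * D > E"
    proof -
      have "(\<bar>E\<bar> / D + 1) * D = \<bar>E\<bar> + D" using D by (simp add: field_simps)
      moreover have "max 1 (\<bar>E\<bar> / D + 1) * D \<ge> (\<bar>E\<bar> / D + 1) * D"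
        using D by (intro mult_right_mono) auto
      ultimately show ?thesis using D by linarith
    qed
    with bound[of "max 1 (\<bar>E\<bar> / D + 1)"] show False by simp
  qed
  define m where "m = (s + t) / 2"
  \<comment> \<open>The diagonal point (m, m) is the midpoint of (s, t) and its mirror image (t,
    s).\<close>
  have "u m m \<le> (1 - 1 / 2) * u s t + (1 / 2) * u t s"
    using convex_onD[OF conv[of s "t - s" t "s - t"], of "1 / 2" 0 1] by (simp add: m_def field_simps)
  then have diag: "u m m \<le> u s t" by (simp add: sym[of t s])
  have "min 0 (6 * m) \<le> u m m"
  proof (rule field_le_epsilon)
    fix \<epsilon> :: real assume "\<epsilon> > 0"
    from near[OF this] obtain s0 t0 where st: "support s0 t0 - \<epsilon> \<le> u s0 t0" by blast
    have "u s0 t0 - u m m \<le> support (s0 - m) (t0 - m)" using slope[of m "s0 - m" m "t0 - m"] by simp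
    also have "\<dots> \<le> support s0 t0 + support (- m) (- m)"
      using support_subadditive[of s0 "- m" t0 "- m"] by simp
    also have "support (- m) (- m) = - min 0 (6 * m)"
      by (simp add: support_def)
    finally show "min 0 (6 * m) \<le> u m m + \<epsilon>" using st by linarith
  qed
  moreover have "6 * m = 3 * (s + t)" by (simp add: m_def)
  ultimately show ?thesis using diag by simp
qed


section \<open>The invariant potentials\<close>

text \<open>In each step the affine piece is chosen by a coordinate of largest modulus, so all
  quotients are at most 1. The finitely many compact polydiscs take the role of compactness of the
  surface.\<close>

lemma surface_covered_by_polydiscs:
  assumes "p \<in> surface"
  shows "\<exists>k < length lifts. \<exists>z. cmod (z $ 0) \<le> 1 \<and> cmod (z $ 1) \<le> 1 \<and> p = chart k z"
proof -
  obtain Z X Y where p: "p = to_point (Z, X, Y)"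
    and nz: "Z \<noteq> 0" "X \<noteq> 0" "Y \<noteq> 0"
    and e1: "Z $ 0 * X $ 1 = Z $ 1 * X $ 0" and e2: "Z $ 0 * Y $ 1 = Z $ 2 * Y $ 0"
    using assms unfolding surface_def by blast
  have ex: ?thesis
    if "k < 5" "cmod (z $ 0) \<le> 1" "cmod (z $ 1) \<le> 1" "to_point (Z, X, Y) = to_point ((lifts ! k) z)" for k z
    using that p by (auto simp: chart_def length_lifts)
  note simps = lift_simps lift_simps[simplified] to_point_eq_iff vec3_eq_iff vec2_eq_iff
  have X: "X $ 0 \<noteq> 0 \<or> X $ 1 \<noteq> 0" and Y: "Y $ 0 \<noteq> 0 \<or> Y $ 1 \<noteq> 0"
    and Z: "Z $ 0 \<noteq> 0 \<or> Z $ 1 \<noteq> 0 \<or> Z $ 2 \<noteq> 0"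
    using nz by (auto simp: vec3_eq_iff vec2_eq_iff)
  have div: "cmod a \<le> cmod b \<Longrightarrow> b \<noteq> 0 \<Longrightarrow> cmod (a / b) \<le> 1" for a b
    by (simp add: norm_divide)
  have X': "X $ 0 \<noteq> 0 \<and> cmod (X $ 1) \<le> cmod (X $ 0) \<or> X $ 1 \<noteq> 0 \<and> cmod (X $ 0) \<le> cmod (X $ 1)"
    using X by (cases "cmod (X $ 1) \<le> cmod (X $ 0)") auto
  have Y': "Y $ 0 \<noteq> 0 \<and> cmod (Y $ 1) \<le> cmod (Y $ 0) \<or> Y $ 1 \<noteq> 0 \<and> cmod (Y $ 0) \<le> cmod (Y $ 1)"
    using Y by (cases "cmod (Y $ 1) \<le> cmod (Y $ 0)") auto
  consider (Z0) "cmod (Z $ 1) \<le> cmod (Z $ 0)" "cmod (Z $ 2) \<le> cmod (Z $ 0)"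
    | (Z1) "cmod (Z $ 0) \<le> cmod (Z $ 1)" "cmod (Z $ 2) \<le> cmod (Z $ 1)"
    | (Z2) "cmod (Z $ 0) \<le> cmod (Z $ 2)" "cmod (Z $ 1) \<le> cmod (Z $ 2)"
    by linarith
  then have Z': "Z $ 0 \<noteq> 0 \<and> cmod (Z $ 1) \<le> cmod (Z $ 0) \<and> cmod (Z $ 2) \<le> cmod (Z $ 0)
      \<or> Z $ 1 \<noteq> 0 \<and> cmod (Z $ 0) \<le> cmod (Z $ 1) \<and> cmod (Z $ 2) \<le> cmod (Z $ 1)
      \<or> Z $ 2 \<noteq> 0 \<and> cmod (Z $ 0) \<le> cmod (Z $ 2) \<and> cmod (Z $ 1) \<le> cmod (Z $ 2)"
    by cases (use Z in auto)
  consider "Z $ 0 \<noteq> 0" "cmod (Z $ 1) \<le> cmod (Z $ 0)" "cmod (Z $ 2) \<le> cmod (Z $ 0)"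
    | "Z $ 1 \<noteq> 0" "cmod (Z $ 0) \<le> cmod (Z $ 1)" "cmod (Z $ 2) \<le> cmod (Z $ 1)" "Y $ 0 \<noteq> 0" "cmod (Y $ 1) \<le> cmod (Y $ 0)"
    | "Z $ 1 \<noteq> 0" "cmod (Z $ 0) \<le> cmod (Z $ 1)" "cmod (Z $ 2) \<le> cmod (Z $ 1)" "Y $ 1 \<noteq> 0" "cmod (Y $ 0) \<le> cmod (Y $ 1)"
    | "Z $ 2 \<noteq> 0" "cmod (Z $ 0) \<le> cmod (Z $ 2)" "cmod (Z $ 1) \<le> cmod (Z $ 2)" "X $ 0 \<noteq> 0" "cmod (X $ 1) \<le> cmod (X $ 0)"
    | "Z $ 2 \<noteq> 0" "cmod (Z $ 0) \<le> cmod (Z $ 2)" "cmod (Z $ 1) \<le> cmod (Z $ 2)" "X $ 1 \<noteq> 0" "cmod (X $ 0) \<le> cmod (X $ 1)"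
    using X' Y' Z' by blast
  then show ?thesis
  proof cases
    case 1
    then have "X $ 0 \<noteq> 0" "Y $ 0 \<noteq> 0" using e1 e2 X Y by auto
    then show ?thesis using 1 e1 e2
      by (intro ex[of 0 "vec2 (Z $ 1 / Z $ 0) (Z $ 2 / Z $ 0)"])
        (simp_all add: div simps, auto intro!: exI[of _ "Z $ 0"] exI[of _ "X $ 0"] exI[of _ "Y $ 0"] simp: field_simps)
  next
    case 2
    then have "X $ 1 \<noteq> 0" using e1 X by auto
    then show ?thesis using 2 e1 e2
      by (intro ex[of 1 "vec2 (Z $ 0 / Z $ 1) (Y $ 1 / Y $ 0)"])
        (simp_all add: div simps, auto intro!: exI[of _ "Z $ 1"] exI[of _ "X $ 1"] exI[of _ "Y $ 0"] simp: field_simps)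
  next
    case 3
    then have "X $ 1 \<noteq> 0" using e1 X by auto
    moreover have "X $ 0 * (Y $ 1 * Z $ 1) = X $ 1 * (Y $ 0 * Z $ 2)"
      using e1 e2 by (metis mult.commute mult.left_commute)
    ultimately show ?thesis using 3 e1 e2
      by (intro ex[of 2 "vec2 (Y $ 0 / Y $ 1) (Z $ 2 / Z $ 1)"])
        (simp_all add: div simps, auto intro!: exI[of _ "Z $ 1"] exI[of _ "X $ 1"] exI[of _ "Y $ 1"] simp: field_simps)
  next
    case 4
    then have "Y $ 1 \<noteq> 0" using e2 Y by auto
    then show ?thesis using 4 e1 e2
      by (intro ex[of 3 "vec2 (Z $ 0 / Z $ 2) (X $ 1 / X $ 0)"])
        (simp_all add: div simps, auto intro!: exI[of _ "Z $ 2"] exI[of _ "X $ 0"] exI[of _ "Y $ 1"] simp: field_simps)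
  next
    case 5
    then have "Y $ 1 \<noteq> 0" using e2 Y by auto
    moreover have "X $ 1 * (Y $ 0 * Z $ 2) = X $ 0 * (Y $ 1 * Z $ 1)"
      using e1 e2 by (metis mult.commute mult.left_commute)
    ultimately show ?thesis using 5 e1 e2
      by (intro ex[of 4 "vec2 (X $ 0 / X $ 1) (Z $ 1 / Z $ 2)"])
        (simp_all add: div simps, auto intro!: exI[of _ "Z $ 2"] exI[of _ "X $ 1"] exI[of _ "Y $ 1"] simp: field_simps)
  qed
qed

(* Needed to use the normalization SUP = 0: the supremum of an unbounded set of reals is unspecified. *)
lemma smooth_on_surface_bdd_above:
  assumes "smooth_on_surface \<phi>"
  shows "bdd_above (\<phi> ` surface)"
proof -
  have "bdd_above ((\<lambda>z. \<phi> (chart k z)) ` cball 0 2)" if "k < length lifts" for k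
  proof -
    have "continuous_on UNIV (\<lambda>z. \<phi> (chart k z))"
      using assms that by (intro smooth_imp_continuous) (simp add: smooth_on_surface_def)
    then have "continuous_on (cball 0 2) (\<lambda>z. \<phi> (chart k z))"
      by (rule continuous_on_subset) simp
    then show ?thesis
      by (intro bounded_imp_bdd_above compact_imp_bounded compact_continuous_image) auto
  qed
  then have "bdd_above (\<Union>k<length lifts. (\<lambda>z. \<phi> (chart k z)) ` cball 0 2)"
    by (subst bdd_above_UN) auto
  moreover have "\<phi> ` surface \<subseteq> (\<Union>k<length lifts. (\<lambda>z. \<phi> (chart k z)) ` cball 0 2)"
  proof
    fix y assume "y \<in> \<phi> ` surface"
    then obtain k z where z: "k < length lifts" "cmod (z $ 0) \<le> 1" "cmod (z $ 1) \<le> 1" "y = \<phi> (chart k z)"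
      using surface_covered_by_polydiscs by blast
    have "norm z \<le> (\<Sum>i\<in>UNIV. cmod (z $ i))"
      unfolding norm_vec_def by (rule L2_set_le_sum) simp
    then have "norm z \<le> 2" using z by (simp add: sum_UNIV_2)
    then show "y \<in> (\<Union>k<length lifts. (\<lambda>z. \<phi> (chart k z)) ` cball 0 2)"
      unfolding z(4) using z(1) by (intro UN_I[of k] imageI) auto
  qed
  ultimately show ?thesis by (rule bdd_above_mono)
qed

text \<open>The two axes are negligible, a nonempty open set is not.\<close>

lemma open_meets_torus:
  assumes "open O'" "O' \<noteq> {}"
  obtains z :: "complex^2" where "z \<in> O'" "z $ 0 \<noteq> 0" "z $ 1 \<noteq> 0"
proof -
  have hyperplane: "negligible {z :: complex^2. axis j 1 \<bullet> z = 0}" for j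
    by (rule negligible_hyperplane) (simp add: axis_eq_0_iff)
  from hyperplane[of 0] hyperplane[of 1] have "negligible ({z :: complex^2. axis 0 1 \<bullet> z = 0} \<union> {z. axis 1 1 \<bullet> z = 0})"
    by (rule negligible_Un)
  then have "\<not> O' \<subseteq> {z. axis 0 1 \<bullet> z = 0} \<union> {z. axis 1 1 \<bullet> z = 0}"
    using open_not_negligible[OF assms] negligible_subset by blast
  then obtain z where "z \<in> O'" "z \<bullet> axis 0 1 \<noteq> 0" "z \<bullet> axis 1 1 \<noteq> 0"
    by (auto simp: inner_commute)
  then show thesis by (intro that[of z]) (auto simp: inner_axis_complex)
qed

context
  fixes \<phi> :: "point \<Rightarrow> real"
  assumes \<phi>: "\<phi> \<in> potentials sym_group"
begin

private lemma smooth: "smooth_on_surface \<phi>"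
  and invariant: "g \<in> sym_group \<Longrightarrow> p \<in> surface \<Longrightarrow> \<phi> (g p) = \<phi> p"
  and positive: "k < length lifts \<Longrightarrow> pos_form (omega k z + ddbar (\<lambda>w. \<phi> (chart k w)) z)"
  and sup: "(SUP p\<in>surface. \<phi> p) = 0"
  using \<phi> by (simp_all add: potentials_def)

private lemma generator_invariant:
  "restrict f surface \<in> sym_gens \<Longrightarrow> p \<in> surface \<Longrightarrow> \<phi> (f p) = \<phi> p"
  using invariant[of "restrict f surface" p] by (simp add: sym_group_def generate.incl)

lemma potential_le_0: "p \<in> surface \<Longrightarrow> \<phi> p \<le> 0"
  using cSUP_upper[OF _ smooth_on_surface_bdd_above[OF smooth]] sup by metis

private lemma chart_0_in_surface: "chart 0 z \<in> surface"
  by (rule chart_in_surface) (simp add: length_lifts)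

lemma potential_rotate:
  assumes c: "cmod c = 1" and d: "cmod d = 1"
  shows "\<phi> (chart 0 (vec2 (c * a) (d * b))) = \<phi> (chart 0 (vec2 a b))"
proof -
  \<comment> \<open>The generators have angles in the half-open interval only, which is the range of
    \<open>Arg2pi\<close>.\<close>
  have ang: "\<exists>\<theta>\<in>{0..<2 * pi}. e = cis \<theta>" if "cmod e = 1" for e
  proof -
    have "e = cis (Arg2pi e)" using Arg2pi_eq[of e] that by (simp add: cis_conv_exp)
    then show ?thesis using Arg2pi[of e] by auto
  qed
  obtain \<theta> where t: "\<theta> \<in> {0..<2 * pi}" "c = cis \<theta>" using ang[OF c] by blast
  obtain \<eta> where e: "\<eta> \<in> {0..<2 * pi}" "d = cis \<eta>" using ang[OF d] by blast
  have 1: "rot1 \<theta> (chart 0 (vec2 a b')) = chart 0 (vec2 (c * a) b')" for b'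
    unfolding chart_def lift_simps gens_to_point t
    by (simp add: mult_coord_def vec3_def vec2_def to_point_eq_iff, intro conjI exI[of _ 1])
      (simp_all add: vec_eq_iff all3 all2)
  have 2: "rot2 \<eta> (chart 0 (vec2 a b)) = chart 0 (vec2 a (d * b))"
    unfolding chart_def lift_simps gens_to_point e
    by (simp add: mult_coord_def vec3_def vec2_def to_point_eq_iff, intro conjI exI[of _ 1])
      (simp_all add: vec_eq_iff all3 all2)
  have "restrict (rot1 \<theta>) surface \<in> sym_gens" "restrict (rot2 \<eta>) surface \<in> sym_gens"
    using t(1) e(1) by (auto simp: sym_gens_def)
  then show ?thesis
    using generator_invariant chart_0_in_surface 1 2 by metis
qed

lemma potential_flip: "\<phi> (chart 0 (vec2 b a)) = \<phi> (chart 0 (vec2 a b))"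
proof -
  have "flip (chart 0 (vec2 a b)) = chart 0 (vec2 b a)"
    unfolding chart_def lift_simps gens_to_point by simp
  moreover have "restrict flip surface \<in> sym_gens" by (simp add: sym_gens_def)
  ultimately show ?thesis using generator_invariant chart_0_in_surface by metis
qed

lemma potential_log_coords:
  assumes "z $ 0 \<noteq> 0" "z $ 1 \<noteq> 0"
  shows "\<phi> (chart 0 z) = \<phi> (chart 0 (log_coords (ln (cmod (z $ 0))) (ln (cmod (z $ 1)))))"
proof -
  have "z = vec2 (sgn (z $ 0) * cmod (z $ 0)) (sgn (z $ 1) * cmod (z $ 1))"
    using assms by (simp add: vec2_eq_iff sgn_div_norm scaleR_conv_of_real)
  then have "\<phi> (chart 0 z) = \<phi> (chart 0 (vec2 (sgn (z $ 0) * cmod (z $ 0)) (sgn (z $ 1) * cmod (z $ 1))))"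
    by simp
  also have "\<dots> = \<phi> (chart 0 (vec2 (cmod (z $ 0)) (cmod (z $ 1))))"
    using assms by (intro potential_rotate) (simp_all add: norm_sgn)
  finally show ?thesis using assms by (simp add: log_coords_def)
qed

text \<open>The supremum may be approached outside the open torus orbit; continuity in a chart moves
  a nearly maximal point into the orbit, and rotation invariance then makes its coordinates
  positive.\<close>

lemma potential_near_0:
  assumes "\<epsilon> > 0"
  obtains s t where "- \<epsilon> < \<phi> (chart 0 (log_coords s t))"
proof -
  have "surface \<noteq> {}" using chart_0_in_surface by blast
  then obtain p where p: "p \<in> surface" "- \<epsilon> < \<phi> p"
    using less_cSUP_iff[OF _ smooth_on_surface_bdd_above[OF smooth], of "- \<epsilon>"] sup assms by auto
  then obtain k z where k: "k < length lifts" "p = chart k z"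
    using surface_covered by blast
  have "continuous_on UNIV (\<lambda>z. \<phi> (chart k z))"
    using smooth k(1) by (intro smooth_imp_continuous) (simp add: smooth_on_surface_def)
  then have "open {z. - \<epsilon> < \<phi> (chart k z)}"
    by (intro open_Collect_less) auto
  moreover have "{z. - \<epsilon> < \<phi> (chart k z)} \<noteq> {}" using p k by auto
  ultimately obtain y where y: "- \<epsilon> < \<phi> (chart k y)" "y $ 0 \<noteq> 0" "y $ 1 \<noteq> 0"
    using open_meets_torus by blast
  obtain w where "w $ 0 \<noteq> 0" "w $ 1 \<noteq> 0" "chart k y = chart 0 w"
    using chart_eq_chart_0[OF k(1) y(2,3)] .
  then show thesis using y(1) potential_log_coords that by metis
qed

lemma potential_lower_bound:
  assumes z: "z $ 0 \<noteq> 0" "z $ 1 \<noteq> 0"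
  shows "min 0 (3 * ln (cmod (z $ 0) * cmod (z $ 1))) \<le> \<phi> (chart 0 z) + ln (weight z)"
proof -
  \<comment> \<open>Convexity belongs to the full local potential of omega + i ddbar phi, not to
    \<open>\<phi>\<close> alone.\<close>
  define U where "U = (\<lambda>z. log_norms ((lifts ! 0) z) + \<phi> (chart 0 z))"
  define u where "u = (\<lambda>s t. U (log_coords s t))"
  have k: "0 < length lifts" by (simp add: length_lifts)
  have td: "twice_differentiable (\<lambda>z. log_norms ((lifts ! 0) z))" "twice_differentiable (\<lambda>z. \<phi> (chart 0 z))"
    using elementary_log_norms_dilate[OF k, of 1] smooth k
    by (auto simp: dilate_1 smooth_on_surface_def intro: twice_differentiable_elementary
        smooth_imp_twice_differentiable)
  have U: "U z = ln (weight z) + \<phi> (chart 0 z)" for z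
    by (simp only: U_def log_norms_lift_0)
  have "min 0 (3 * (s + t)) \<le> u s t" for s t
  proof (rule symmetric_convex_lower_bound[where K = "ln 3 + 2 * ln 2"])
    show "convex_on UNIV (\<lambda>x. u (s + m * x) (t + n * x))" for s t m n
      unfolding u_def
    proof (rule convex_on_log_line)
      show "twice_differentiable U" unfolding U_def by (intro twice_differentiable_add td)
      show "pos_form (ddbar U z)" for z
        using positive[OF k, of z] unfolding U_def ddbar_add[OF td] omega_def .
      show "U (vec2 (c * a) (d * b)) = U (vec2 a b)" if "cmod c = 1" "cmod d = 1" for a b c d
        using potential_rotate[OF that] that unfolding U by (simp add: weight_def norm_mult)
    qed
    show "u s t = u t s" for s t
      unfolding u_def U log_coords_def using potential_flip
      by (simp add: weight_def add_ac mult_ac)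
    show "u s t \<le> support s t + (ln 3 + 2 * ln 2)" for s t
      unfolding u_def U
      using ln_weight_bounds(2)[of s t] potential_le_0[OF chart_0_in_surface[of "log_coords s t"]] by linarith
    show "\<exists>s t. support s t - \<epsilon> \<le> u s t" if e: "\<epsilon> > 0" for \<epsilon>
    proof -
      obtain s t where "- \<epsilon> < \<phi> (chart 0 (log_coords s t))" using potential_near_0[OF e] .
      then show ?thesis unfolding u_def U using ln_weight_bounds(1)[of s t] by (intro exI[of _ s] exI[of _ t]) linarith
    qed
  qed
  from this[of "ln (cmod (z $ 0))" "ln (cmod (z $ 1))"] show ?thesis
    using z unfolding u_def U potential_log_coords[OF z]
    by (simp add: ln_mult log_coords_def weight_def add_ac)
qed

end

theorem theorem1:
  shows "alpha_invariant sym_group = ereal (1 / 3)"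
proof -
  define A where "A = {\<alpha>::real. \<alpha> > 0 \<and> (\<exists>C>0. \<forall>\<phi>\<in>potentials sym_group.
        integral_omega_sq (\<lambda>p. ennreal (exp (- \<alpha> * \<phi> p))) \<le> ennreal C)}"
  have upper: "\<alpha> \<le> 1 / 3" if "\<alpha> \<in> A" for \<alpha>
    using that exponent_le_third unfolding A_def by blast
  have lower: "\<alpha> \<in> A" if "0 < \<alpha>" "\<alpha> < 1 / 3" for \<alpha>
    using integral_omega_sq_bounded[OF that] potential_lower_bound that(1) unfolding A_def by blast
  have "Sup (ereal ` A) = ereal (1 / 3)"
  proof (rule antisym)
    show "Sup (ereal ` A) \<le> ereal (1 / 3)" using upper by (auto intro!: SUP_least)
    show "ereal (1 / 3) \<le> Sup (ereal ` A)"
    \<comment> \<open>Integrability is known only strictly below 1/3, so the supremum is reached by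
      approximation; the maximum with 0 keeps the chosen exponent positive.\<close>
    proof (rule dense_le)
      fix x assume x: "x < ereal (1 / 3)"
      have "max x 0 < ereal (1 / 3)" using x by simp
      then obtain y where "max x 0 < ereal y" "ereal y < ereal (1 / 3)"
        using ereal_dense2 by blast
      then have "y \<in> A" "x \<le> ereal y" by (auto intro!: lower less_imp_le)
      then show "x \<le> Sup (ereal ` A)" by (meson SUP_upper order_trans)
    qed
  qed
  then show ?thesis unfolding alpha_invariant_def A_def .
qed

end
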